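(* Let $\mathbb K$ be a field of characteristic $0$, let $S$ be a locally finite root system and let $\Lambda$ be a torsion-free abelian group. Then every invariant predivision-$(S,\Lambda)$-graded Lie algebra $L$ over $\mathbb K$ arises as the centreless core of an invariant affine reflection algebra over $\mathbb K$.
   Context: **Root-graded Lie algebras.** A locally finite root system is a subset $S$ of a $\mathbb K$-vector space $Y$ with $0\in S$, $S$ spanning $Y$, $|S\cap V|<\infty$ for finite-dimensional subspaces $V\subset Y$, together with $\alpha^\vee\in Y^*$ for $0\neq\alpha\in S$ such that $\langle\alpha,\alpha^\vee\rangle=2$, $s_\alpha(S)=S$ for $s_\alpha(y)=y-\langle y,\alpha^\vee\rangle\alpha$, and $\langle S,\alpha^\vee\rangle\subset\mathbb Z$. Put $S^\times=S\setminus\{0\}$, $S_{\rm ind}=\{0\}\cup\{\alpha\in S:\alpha/2\notin S\}$, $\mathcal Q(S)=\operatorname{Span}_{\mathbb Z}S$. Let $L=\bigoplus_{q\in\mathcal Q(S),\lambda\in\Lambda}L_q^\lambda$ be a $(\mathcal Q(S)\oplus\Lambda)$-graded Lie algebra over $\mathbb K$, $L_q=\bigoplus_\lambda L_q^\lambda$, $L^\lambda=\bigoplus_qL_q^\lambda$. A non-zero $e\in L_\alpha^\lambda$ ($\alpha\in S^\times$) is invertible, with inverse $f\in L_{-\alpha}^{-\lambda}$, if $h=[f,e]$ satisfies $[h,x]=\langle q,\alpha^\vee\rangle x$ for all $q\in\mathcal Q(S)$, $x\in L_q$. $L$ is predivision-$(S,\Lambda)$-graded if (RG1) $L_q=0$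 for $q\notin S$; (RG2) every $L_\alpha^0$, $0\neq\alpha\in S_{\rm ind}$, contains an invertible element; (RG3) $L_0=\sum_{0\ne\alpha\in S}[L_\alpha,L_{-\alpha}]$; and every non-zero $L_\alpha^\lambda$, $\alpha\in S^\times$, contains an invertible element. It is invariant if it has an invariant ($([a,b]|c)=(a|[b,c])$) nondegenerate symmetric bilinear form that is $\Lambda$-graded ($(L^\lambda|L^\mu)=0$ for $\lambda+\mu\neq0$) and whose restriction to $\operatorname{Span}\{[e_\alpha,f_\alpha]:0\ne\alpha\in S_{\rm ind}\}$ is nondegenerate for some choice of invertible elements $e_\alpha\in L_\alpha^0$ with inverses $f_\alpha$. **Invariant affine reflection algebras.** A toral pair $(E,T)$ is a non-zero Lie algebra $E$ over $\mathbb K$ with a subspace $T$ such that $E=\bigoplus_{\alpha\in T^*}E_\alpha$, $E_\alpha=\{x:[t,x]=\alpha(t)x\ \forall t\in T\}$; its set of roots is $R=\{\alpha:E_\alpha\ne0\}$. It is an invariant affine reflection algebra if: (IA1) $E$ has an invariant nondegenerate symmetric bilinear form $(\cdot|\cdot)$ whose restriction to $T\times T$ is nondegenerate, and for every $\alpha\in R$ there is $t_\alpha\in T$ with $(t_\alpha|t)=\alpha(t)$ for all $t\in T$; (IA2) for every $0\ne\alpha\in R$ there are $e_{\pm\alpha}\in E_{\pm\alpha}$ with $0\ne[e_\alpha,e_{-\alpha}]\in T$; (IA3) $\operatorname{ad}x_\alpha$ is locally nilpotent on $E$ for all $x_\alpha\in E_\alpha$, $\alpha\in R^{\rm an}:=\{\alpha\in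 R:(t_\alpha|t_\alpha)\ne0\}$. The core $E_c$ is the subalgebra generated by $\{E_\alpha:\alpha\in R^{\rm an}\}$; the centreless core is $E_c/\mathrm Z(E_c)$, where $\mathrm Z(E_c)$ is the centre of $E_c$. "Arises as the centreless core" is understood up to isomorphism of Lie algebras. *)

theory Defs
  imports
    Complex_Main
    "HOL-Library.Function_Algebras"
    "HOL-Library.Product_Plus"
    "HOL-Library.Set_Algebras"
begin

text \<open>
  Lie algebras, root systems and grading groups that are given data live in arbitrary types with
  an explicit scalar multiplication. A Lie algebra is a subspace \<open>L\<close> of an ambient vector
  space; nothing is assumed about the bracket outside \<open>L\<close>.
\<close>

section \<open>Vector space preliminaries\<close>

context vector_space
begin

definition internal_direct_sum :: "'i set \<Rightarrow> ('i \<Rightarrow> 'b set) \<Rightarrow> 'b set \<Rightarrow> bool" where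
  "internal_direct_sum I M V \<longleftrightarrow>
     (\<forall>i\<in>I. subspace (M i)) \<and>
     span (\<Union>i\<in>I. M i) = V \<and>
     (\<forall>F x. finite F \<and> F \<subseteq> I \<and> (\<forall>i\<in>F. x i \<in> M i) \<and> (\<Sum>i\<in>F. x i) = 0 \<longrightarrow> (\<forall>i\<in>F. x i = 0))"

definition finite_dim_subspace :: "'b set \<Rightarrow> bool" where
  "finite_dim_subspace V \<longleftrightarrow> (\<exists>B. finite B \<and> V = span B)"

text \<open>The dual space of a subspace \<open>V\<close>; its elements are made unique as functions on the
  ambient type by letting them vanish outside \<open>V\<close>, so that \<open>0\<close> and \<open>- \<alpha>\<close> are
  the pointwise operations of \<^theory>\<open>HOL-Library.Function_Algebras\<close>.\<close>

definition dual_on :: "'b set \<Rightarrow> ('b \<Rightarrow> 'a) set" where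
  "dual_on V = {\<alpha>. (\<forall>x\<in>V. \<forall>y\<in>V. \<alpha> (x + y) = \<alpha> x + \<alpha> y) \<and>
                   (\<forall>c. \<forall>x\<in>V. \<alpha> (scale c x) = c * \<alpha> x) \<and>
                   (\<forall>x. x \<notin> V \<longrightarrow> \<alpha> x = 0)}"

definition symmetric_bilinear_on :: "'b set \<Rightarrow> ('b \<Rightarrow> 'b \<Rightarrow> 'a) \<Rightarrow> bool" where
  "symmetric_bilinear_on V \<phi> \<longleftrightarrow>
     (\<forall>x\<in>V. \<forall>y\<in>V. \<forall>z\<in>V. \<phi> (x + y) z = \<phi> x z + \<phi> y z) \<and>
     (\<forall>c. \<forall>x\<in>V. \<forall>y\<in>V. \<phi> (scale c x) y = c * \<phi> x y) \<and>
     (\<forall>x\<in>V. \<forall>y\<in>V. \<phi> x y = \<phi> y x)"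

end

definition nondegenerate_on :: "'v::zero set \<Rightarrow> ('v \<Rightarrow> 'v \<Rightarrow> 'k::zero) \<Rightarrow> bool" where
  "nondegenerate_on V \<phi> \<longleftrightarrow> (\<forall>x\<in>V. (\<forall>y\<in>V. \<phi> x y = 0) \<longrightarrow> x = 0)"

definition torsion_free_group :: "'g::ab_group_add itself \<Rightarrow> bool" where
  "torsion_free_group _ \<longleftrightarrow> (\<forall>(x::'g) (n::nat). n > 0 \<and> (\<Sum>i<n. x) = 0 \<longrightarrow> x = 0)"

section \<open>Lie algebras\<close>

locale lie_algebra = vector_space scale
  for scale :: "'k::field_char_0 \<Rightarrow> 'v::ab_group_add \<Rightarrow> 'v" +
  fixes L :: "'v set" and br :: "'v \<Rightarrow> 'v \<Rightarrow> 'v"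
  assumes subspace_L: "subspace L"
    and br_closed: "\<lbrakk>x \<in> L; y \<in> L\<rbrakk> \<Longrightarrow> br x y \<in> L"
    and br_add_left: "\<lbrakk>x \<in> L; y \<in> L; z \<in> L\<rbrakk> \<Longrightarrow> br (x + y) z = br x z + br y z"
    and br_add_right: "\<lbrakk>x \<in> L; y \<in> L; z \<in> L\<rbrakk> \<Longrightarrow> br x (y + z) = br x y + br x z"
    and br_scale_left: "\<lbrakk>x \<in> L; y \<in> L\<rbrakk> \<Longrightarrow> br (scale c x) y = scale c (br x y)"
    and br_scale_right: "\<lbrakk>x \<in> L; y \<in> L\<rbrakk> \<Longrightarrow> br x (scale c y) = scale c (br x y)"
    and br_alternating: "x \<in> L \<Longrightarrow> br x x = 0"
    and jacobi: "\<lbrakk>x \<in> L; y \<in> L; z \<in> L\<rbrakk> \<Longrightarrow> br x (br y z) + br y (br z x) + br z (br x y) = 0"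
begin

definition lie_subalgebra :: "'v set \<Rightarrow> bool" where
  "lie_subalgebra A \<longleftrightarrow> subspace A \<and> A \<subseteq> L \<and> (\<forall>x\<in>A. \<forall>y\<in>A. br x y \<in> A)"

definition invariant_form :: "('v \<Rightarrow> 'v \<Rightarrow> 'k) \<Rightarrow> bool" where
  "invariant_form \<phi> \<longleftrightarrow>
     symmetric_bilinear_on L \<phi> \<and> (\<forall>a\<in>L. \<forall>b\<in>L. \<forall>c\<in>L. \<phi> (br a b) c = \<phi> a (br b c))"

end

definition lie_centre :: "('v::zero \<Rightarrow> 'v \<Rightarrow> 'v) \<Rightarrow> 'v set \<Rightarrow> 'v set" where
  "lie_centre br A = {z\<in>A. \<forall>x\<in>A. br z x = 0}"

text \<open>
  The quotient of a Lie algebra \<open>A\<close> by an ideal \<open>I\<close> has the cosets \<open>x +o I\<close> as elements.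
  Addition of cosets is elementwise addition of sets; the remaining operations are induced from
  representatives, all choices of which give the same coset.
\<close>

definition quotient_carrier :: "'v::ab_group_add set \<Rightarrow> 'v set \<Rightarrow> 'v set set" where
  "quotient_carrier A I = (\<lambda>x. x +o I) ` A"

definition quotient_scale ::
  "('k \<Rightarrow> 'v \<Rightarrow> 'v) \<Rightarrow> 'v::ab_group_add set \<Rightarrow> 'k \<Rightarrow> 'v set \<Rightarrow> 'v set" where
  "quotient_scale scale I c X = (\<Union>x\<in>X. scale c x +o I)"

definition quotient_bracket ::
  "('v \<Rightarrow> 'v \<Rightarrow> 'v) \<Rightarrow> 'v::ab_group_add set \<Rightarrow> 'v set \<Rightarrow> 'v set \<Rightarrow> 'v set" where
  "quotient_bracket br I X Y = (\<Union>x\<in>X. \<Union>y\<in>Y. br x y +o I)"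

text \<open>Isomorphism is stated for explicit operations, because a quotient is not a subspace of a
  type of class \<^class>\<open>ab_group_add\<close>.\<close>

definition lie_isomorphic ::
  "'a set \<Rightarrow> ('a \<Rightarrow> 'a \<Rightarrow> 'a) \<Rightarrow> ('k \<Rightarrow> 'a \<Rightarrow> 'a) \<Rightarrow> ('a \<Rightarrow> 'a \<Rightarrow> 'a) \<Rightarrow>
   'b set \<Rightarrow> ('b \<Rightarrow> 'b \<Rightarrow> 'b) \<Rightarrow> ('k \<Rightarrow> 'b \<Rightarrow> 'b) \<Rightarrow> ('b \<Rightarrow> 'b \<Rightarrow> 'b) \<Rightarrow> bool" where
  "lie_isomorphic A add\<^sub>A scale\<^sub>A br\<^sub>A B add\<^sub>B scale\<^sub>B br\<^sub>B \<longleftrightarrow>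
     (\<exists>f. bij_betw f A B \<and>
        (\<forall>x\<in>A. \<forall>y\<in>A. f (add\<^sub>A x y) = add\<^sub>B (f x) (f y)) \<and>
        (\<forall>c. \<forall>x\<in>A. f (scale\<^sub>A c x) = scale\<^sub>B c (f x)) \<and>
        (\<forall>x\<in>A. \<forall>y\<in>A. f (br\<^sub>A x y) = br\<^sub>B (f x) (f y)))"

section \<open>Locally finite root systems\<close>

text \<open>The pairing \<open>\<langle>y, \<alpha>\<^sup>\<or>\<rangle>\<close> is written \<open>coroot \<alpha> y\<close>.\<close>

locale locally_finite_root_system = vector_space scaleY
  for scaleY :: "'k::field_char_0 \<Rightarrow> 'y::ab_group_add \<Rightarrow> 'y" +
  fixes S :: "'y set" and coroot :: "'y \<Rightarrow> 'y \<Rightarrow> 'k"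
  assumes zero_in_S: "0 \<in> S"
    and span_S: "span S = UNIV"
    and locally_finite: "finite_dim_subspace V \<Longrightarrow> finite (S \<inter> V)"
    and coroot_linear: "\<lbrakk>\<alpha> \<in> S; \<alpha> \<noteq> 0\<rbrakk> \<Longrightarrow> Vector_Spaces.linear scaleY (*) (coroot \<alpha>)"
    and coroot_self: "\<lbrakk>\<alpha> \<in> S; \<alpha> \<noteq> 0\<rbrakk> \<Longrightarrow> coroot \<alpha> \<alpha> = 2"
    and reflection_S: "\<lbrakk>\<alpha> \<in> S; \<alpha> \<noteq> 0\<rbrakk> \<Longrightarrow> (\<lambda>y. y - scaleY (coroot \<alpha> y) \<alpha>) ` S = S"
    and coroot_integral: "\<lbrakk>\<alpha> \<in> S; \<alpha> \<noteq> 0; \<beta> \<in> S\<rbrakk> \<Longrightarrow> coroot \<alpha> \<beta> \<in> \<int>"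
begin

definition S_ind :: "'y set" where
  "S_ind = {0} \<union> {\<alpha>\<in>S. scaleY (1/2) \<alpha> \<notin> S}"

text \<open>The \<open>\<int>\<close>-span of \<open>S\<close>.\<close>

definition root_lattice :: "'y set" where
  "root_lattice = module.span (\<lambda>n::int. scaleY (of_int n)) S"

end

section \<open>Root-graded Lie algebras\<close>

text \<open>\<open>G q \<mu>\<close> is the homogeneous space \<open>L\<^sub>q\<^sup>\<mu>\<close>; only \<open>q\<close> in the
  root lattice is relevant. The group \<open>\<Lambda>\<close> is the type \<open>'g\<close>.\<close>

locale root_lattice_graded_lie_algebra =
  lie: lie_algebra scaleL L br + root: locally_finite_root_system scaleY S coroot
  for scaleL :: "'k::field_char_0 \<Rightarrow> 'l::ab_group_add \<Rightarrow> 'l"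
    and L :: "'l set" and br :: "'l \<Rightarrow> 'l \<Rightarrow> 'l"
    and scaleY :: "'k \<Rightarrow> 'y::ab_group_add \<Rightarrow> 'y"
    and S :: "'y set" and coroot :: "'y \<Rightarrow> 'y \<Rightarrow> 'k" +
  fixes G :: "'y \<Rightarrow> 'g::ab_group_add \<Rightarrow> 'l set"
  assumes grading_sum:
      "lie.internal_direct_sum (root.root_lattice \<times> UNIV) (\<lambda>(q, \<mu>). G q \<mu>) L"
    and grading_br:
      "\<lbrakk>p \<in> root.root_lattice; q \<in> root.root_lattice; x \<in> G p \<mu>; y \<in> G q \<nu>\<rbrakk>
        \<Longrightarrow> br x y \<in> G (p + q) (\<mu> + \<nu>)"
begin

definition root_part :: "'y \<Rightarrow> 'l set" where
  "root_part q = lie.span (\<Union>\<mu>. G q \<mu>)"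

definition Lambda_part :: "'g \<Rightarrow> 'l set" where
  "Lambda_part \<mu> = lie.span (\<Union>q\<in>root.root_lattice. G q \<mu>)"

definition invertible_with_inverse :: "'y \<Rightarrow> 'g \<Rightarrow> 'l \<Rightarrow> 'l \<Rightarrow> bool" where
  "invertible_with_inverse \<alpha> \<mu> e f \<longleftrightarrow>
     e \<noteq> 0 \<and> e \<in> G \<alpha> \<mu> \<and> f \<in> G (- \<alpha>) (- \<mu>) \<and>
     (\<forall>q\<in>root.root_lattice. \<forall>x\<in>root_part q. br (br f e) x = scaleL (coroot \<alpha> q) x)"

definition invertible :: "'y \<Rightarrow> 'g \<Rightarrow> 'l \<Rightarrow> bool" where
  "invertible \<alpha> \<mu> e \<longleftrightarrow> (\<exists>f. invertible_with_inverse \<alpha> \<mu> e f)"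

end

locale predivision_root_graded_lie_algebra =
  root_lattice_graded_lie_algebra scaleL L br scaleY S coroot G
  for scaleL :: "'k::field_char_0 \<Rightarrow> 'l::ab_group_add \<Rightarrow> 'l"
    and L :: "'l set" and br :: "'l \<Rightarrow> 'l \<Rightarrow> 'l"
    and scaleY :: "'k \<Rightarrow> 'y::ab_group_add \<Rightarrow> 'y"
    and S :: "'y set" and coroot :: "'y \<Rightarrow> 'y \<Rightarrow> 'k"
    and G :: "'y \<Rightarrow> 'g::ab_group_add \<Rightarrow> 'l set" +
  assumes RG1: "\<lbrakk>q \<in> root.root_lattice; q \<notin> S\<rbrakk> \<Longrightarrow> root_part q = {0}"
    and RG2: "\<lbrakk>\<alpha> \<in> root.S_ind; \<alpha> \<noteq> 0\<rbrakk> \<Longrightarrow> \<exists>e. invertible \<alpha> 0 e"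
    and RG3: "root_part 0 =
      lie.span (\<Union>\<alpha>\<in>S - {0}. {br x y |x y. x \<in> root_part \<alpha> \<and> y \<in> root_part (- \<alpha>)})"
    and predivision: "\<lbrakk>\<alpha> \<in> S; \<alpha> \<noteq> 0; G \<alpha> \<mu> \<noteq> {0}\<rbrakk> \<Longrightarrow> \<exists>e. invertible \<alpha> \<mu> e"

locale invariant_predivision_root_graded_lie_algebra =
  predivision_root_graded_lie_algebra scaleL L br scaleY S coroot G
  for scaleL :: "'k::field_char_0 \<Rightarrow> 'l::ab_group_add \<Rightarrow> 'l"
    and L :: "'l set" and br :: "'l \<Rightarrow> 'l \<Rightarrow> 'l"
    and scaleY :: "'k \<Rightarrow> 'y::ab_group_add \<Rightarrow> 'y"
    and S :: "'y set" and coroot :: "'y \<Rightarrow> 'y \<Rightarrow> 'k"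
    and G :: "'y \<Rightarrow> 'g::ab_group_add \<Rightarrow> 'l set" +
  assumes invariant:
    "\<exists>\<phi>. lie.invariant_form \<phi> \<and> nondegenerate_on L \<phi> \<and>
       (\<forall>\<mu> \<nu>. \<mu> + \<nu> \<noteq> 0 \<longrightarrow> (\<forall>x\<in>Lambda_part \<mu>. \<forall>y\<in>Lambda_part \<nu>. \<phi> x y = 0)) \<and>
       (\<exists>e f. (\<forall>\<alpha>\<in>root.S_ind - {0}. invertible_with_inverse \<alpha> 0 (e \<alpha>) (f \<alpha>)) \<and>
          nondegenerate_on (lie.span {br (e \<alpha>) (f \<alpha>) |\<alpha>. \<alpha> \<in> root.S_ind - {0}}) \<phi>)"

section \<open>Invariant affine reflection algebras\<close>

locale toral_pair = lie_algebra scale E br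
  for scale :: "'k::field_char_0 \<Rightarrow> 'v::ab_group_add \<Rightarrow> 'v"
    and E :: "'v set" and br :: "'v \<Rightarrow> 'v \<Rightarrow> 'v" +
  fixes T :: "'v set"
  assumes nonzero: "E \<noteq> {0}"
    and subspace_T: "subspace T" "T \<subseteq> E"
    and root_decomposition:
      "internal_direct_sum (dual_on T) (\<lambda>\<alpha>. {x\<in>E. \<forall>t\<in>T. br t x = scale (\<alpha> t) x}) E"
begin

definition root_space :: "('v \<Rightarrow> 'k) \<Rightarrow> 'v set" where
  "root_space \<alpha> = {x\<in>E. \<forall>t\<in>T. br t x = scale (\<alpha> t) x}"

definition roots :: "('v \<Rightarrow> 'k) set" where
  "roots = {\<alpha>\<in>dual_on T. root_space \<alpha> \<noteq> {0}}"

text \<open>The element \<open>t\<^sub>\<alpha>\<close>, unique if \<open>\<phi>\<close> is nondegenerate on \<open>T\<close>.\<close>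

definition root_vector :: "('v \<Rightarrow> 'v \<Rightarrow> 'k) \<Rightarrow> ('v \<Rightarrow> 'k) \<Rightarrow> 'v" where
  "root_vector \<phi> \<alpha> = (THE t. t \<in> T \<and> (\<forall>s\<in>T. \<phi> t s = \<alpha> s))"

definition anisotropic_roots :: "('v \<Rightarrow> 'v \<Rightarrow> 'k) \<Rightarrow> ('v \<Rightarrow> 'k) set" where
  "anisotropic_roots \<phi> = {\<alpha>\<in>roots. \<phi> (root_vector \<phi> \<alpha>) (root_vector \<phi> \<alpha>) \<noteq> 0}"

definition core :: "('v \<Rightarrow> 'v \<Rightarrow> 'k) \<Rightarrow> 'v set" where
  "core \<phi> = lie_subalgebra hull (\<Union>\<alpha>\<in>anisotropic_roots \<phi>. root_space \<alpha>)"

end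

text \<open>The form is a parameter, since the anisotropic roots and the core refer to it.\<close>

locale invariant_affine_reflection_algebra = toral_pair scale E br T
  for scale :: "'k::field_char_0 \<Rightarrow> 'v::ab_group_add \<Rightarrow> 'v"
    and E :: "'v set" and br :: "'v \<Rightarrow> 'v \<Rightarrow> 'v" and T :: "'v set" +
  fixes \<phi> :: "'v \<Rightarrow> 'v \<Rightarrow> 'k"
  assumes IA1_form: "invariant_form \<phi>" "nondegenerate_on E \<phi>" "nondegenerate_on T \<phi>"
    and IA1_root_vector: "\<alpha> \<in> roots \<Longrightarrow> \<exists>t\<in>T. \<forall>s\<in>T. \<phi> t s = \<alpha> s"
    and IA2: "\<lbrakk>\<alpha> \<in> roots; \<alpha> \<noteq> 0\<rbrakk> \<Longrightarrow>
      \<exists>x\<in>root_space \<alpha>. \<exists>y\<in>root_space (- \<alpha>). br x y \<noteq> 0 \<and> br x y \<in> T"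
    and IA3: "\<lbrakk>\<alpha> \<in> anisotropic_roots \<phi>; x \<in> root_space \<alpha>; y \<in> E\<rbrakk> \<Longrightarrow> \<exists>n. (br x ^^ n) y = 0"

text \<open>
  HOL cannot quantify existentially over types, so an ambient type has to be named for the affine
  reflection algebra to be constructed, which is then some subspace of it with some bracket.
  This type has room for \<open>L \<oplus> N \<oplus> D \<oplus> C\<close>, where \<open>N\<close> is a copy of the group algebra
  \<open>K[\<Lambda>]\<close>, \<open>D\<close> consists of the degree derivations, given by homomorphisms
  \<open>\<Lambda> \<rightarrow> K\<close>, and \<open>C\<close> of linear functionals on \<open>D\<close>.
\<close>

type_synonym ('k, 'l, 'g) reflection_ambient =
  "'l \<times> ('g \<Rightarrow> 'k) \<times> ('g \<Rightarrow> 'k) \<times> (('g \<Rightarrow> 'k) \<Rightarrow> 'k)"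

end

theory Submission
  imports Defs
begin

text \<open>
  The algebra \<open>L\<close> is enlarged to \<open>E = L \<oplus> N \<oplus> D \<oplus> C\<close>. Here \<open>D = Hom(\<Lambda>, K)\<close>
  acts on \<open>L\<close> by degree derivations, \<open>C\<close> is its dual space, which becomes central, and
  \<open>N = K[\<Lambda>]\<close> is an abelian algebra whose basis vectors satisfy
  \<open>(z\<^sup>\<mu> | z\<^sup>\<nu>) = 1\<close> if \<open>\<mu> + \<nu> = 0\<close> and \<open>0\<close> otherwise. Degree derivations are skew
  for the forms of \<open>L\<close> and \<open>N\<close>, because these forms are \<open>\<Lambda>\<close>-graded; hence \<open>(d x | y)\<close>,
  as a function of \<open>d\<close>, is a cocycle with values in \<open>C\<close>, and \<open>E\<close> is a Lie algebra whose
  invariant form pairs \<open>D\<close> with \<open>C\<close> (locale \<open>degree_extension\<close>). The torus \<open>T\<close> is the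
  sum of the span of the elements \<open>[e\<^sub>\<alpha>, f\<^sub>\<alpha>]\<close> with \<open>D\<close> and \<open>C\<close>.

  A homogeneous element of degree \<open>(q, \<mu>)\<close> is a weight vector for \<open>T\<close>, and every root is the
  weight \<open>\<beta>\<close> of such an element (\<open>root_cases\<close>). If \<open>q \<noteq> 0\<close>, it is also the weight of an invertible
  element \<open>u\<close> with inverse \<open>v\<close>. Since \<open>L\<close> is perfect, the form forces its centre to vanish
  (\<open>centreless\<close>), so \<open>h = [v, u]\<close> is determined by its action and lies in \<open>T\<close>
  (\<open>coroot_element_in_cartan\<close>). Invariance then identifies \<open>t\<^sub>\<beta>\<close> with a multiple of \<open>h\<close> plus the
  evaluation at \<open>\<mu>\<close>, and \<open>\<beta>(h) = 2\<close> shows that \<open>\<beta>\<close> is anisotropic (\<open>datum_root_vector\<close>). If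
  \<open>q = 0\<close>, then \<open>t\<^sub>\<beta>\<close> is the evaluation at \<open>\<mu>\<close>, and \<open>\<beta>\<close> is isotropic. The summand
  \<open>N\<close> is there for these roots: brackets of \<open>L\<^sub>0\<^sup>\<mu>\<close> with its opposite need not lie in
  \<open>T\<close>, but \<open>[z\<^sup>\<mu>, z\<^sup>\<nu>]\<close> with \<open>\<nu> = - \<mu>\<close> is the evaluation at \<open>\<mu>\<close>, which is non-zero when
  \<open>\<beta> \<noteq> 0\<close>.

  Local nilpotency comes from the root system. At \<open>h\<close> every root of \<open>E\<close> takes a Cartan integer as
  value, and local finiteness bounds these by \<open>4\<close> (\<open>coroot_product_bound\<close>,
  \<open>root_value_bound\<close>). As \<open>\<beta>(h) = 2\<close>, five applications of \<open>ad x\<close> with \<open>x\<close> of weight \<open>\<beta>\<close> leave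
  this range.

  Finally, the anisotropic root spaces lie in \<open>L\<close> and contain all \<open>L\<^sub>q\<^sup>\<mu>\<close> with \<open>q \<noteq> 0\<close>,
  which generate \<open>L\<close>. The core therefore lies in \<open>L \<oplus> C\<close> and projects onto \<open>L\<close>, and since \<open>L\<close> has
  no centre, the kernel of the projection is the centre of the core.
\<close>

section \<open>Diagonal maps and weight spaces\<close>

context vector_space
begin

text \<open>
  Maps acting by scalars on the summands: degree derivations are of this form, and so are the
  projections onto root spaces.
\<close>

lemma internal_direct_sum_diagonal_map:
  assumes ds: "internal_direct_sum I M V"
  obtains f where "\<And>x y. \<lbrakk>x \<in> V; y \<in> V\<rbrakk> \<Longrightarrow> f (x + y) = f x + f y"
    and "\<And>a x. x \<in> V \<Longrightarrow> f (a *s x) = a *s f x"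
    and "\<And>i x. \<lbrakk>i \<in> I; x \<in> M i\<rbrakk> \<Longrightarrow> f x = c i *s x"
proof -
  define R where "R x z \<longleftrightarrow> (\<exists>F u. finite F \<and> F \<subseteq> I \<and> (\<forall>i\<in>F. u i \<in> M i) \<and>
    x = (\<Sum>i\<in>F. u i) \<and> z = (\<Sum>i\<in>F. c i *s u i))" for x z
  have sub: "subspace (M i)" if "i \<in> I" for i
    using ds that by (auto simp: internal_direct_sum_def)
  have R_add: "R (x + y) (z + w)" if xz: "R x z" and yw: "R y w" for x y z w
  proof -
    obtain F u where F: "finite F" "F \<subseteq> I" "\<forall>i\<in>F. u i \<in> M i"
      "x = (\<Sum>i\<in>F. u i)" "z = (\<Sum>i\<in>F. c i *s u i)"
      using xz by (auto simp: R_def)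
    obtain F' u' where F': "finite F'" "F' \<subseteq> I" "\<forall>i\<in>F'. u' i \<in> M i"
      "y = (\<Sum>i\<in>F'. u' i)" "w = (\<Sum>i\<in>F'. c i *s u' i)"
      using yw by (auto simp: R_def)
    define v where "v i = (if i \<in> F then u i else 0)" for i
    define v' where "v' i = (if i \<in> F' then u' i else 0)" for i
    have "x = (\<Sum>i\<in>F \<union> F'. v i)" "z = (\<Sum>i\<in>F \<union> F'. c i *s v i)"
      unfolding F by (rule sum.mono_neutral_cong_left; use F F' in \<open>auto simp: v_def\<close>)+
    moreover have "y = (\<Sum>i\<in>F \<union> F'. v' i)" "w = (\<Sum>i\<in>F \<union> F'. c i *s v' i)"
      unfolding F' by (rule sum.mono_neutral_cong_left; use F F' in \<open>auto simp: v'_def\<close>)+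
    moreover have "v i + v' i \<in> M i" if "i \<in> F \<union> F'" for i
      using that F F' sub[of i] by (intro subspace_add) (auto simp: v_def v'_def subspace_0)
    ultimately show ?thesis
      unfolding R_def using F F'
      by (intro exI[of _ "F \<union> F'"] exI[of _ "\<lambda>i. v i + v' i"])
        (auto simp: sum.distrib scale_right_distrib)
  qed
  have R_scale: "R (a *s x) (a *s z)" if xz: "R x z" for a x z
  proof -
    obtain F u where F: "finite F" "F \<subseteq> I" "\<forall>i\<in>F. u i \<in> M i"
      "x = (\<Sum>i\<in>F. u i)" "z = (\<Sum>i\<in>F. c i *s u i)"
      using xz by (auto simp: R_def)
    then show ?thesis
      unfolding R_def using sub
      by (intro exI[of _ F] exI[of _ "\<lambda>i. a *s u i"])
        (auto simp: scale_sum_right mult.commute intro: subspace_scale)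
  qed
  have R_zero: "z = 0" if Rz: "R 0 z" for z
  proof -
    obtain F u where F: "finite F" "F \<subseteq> I" "\<forall>i\<in>F. u i \<in> M i"
      "0 = (\<Sum>i\<in>F. u i)" "z = (\<Sum>i\<in>F. c i *s u i)"
      using Rz unfolding R_def by blast
    have "\<forall>i\<in>F. u i = 0"
      using ds F(1-3) F(4)[symmetric] by (simp add: internal_direct_sum_def)
    then show ?thesis using F(5) by simp
  qed
  have R_unique: "z = z'" if "R x z" "R x z'" for x z z'
    using R_zero[of "z - z'"] R_add[OF that(1) R_scale[OF that(2), of "- 1"]] by simp
  have R_base: "R x (c i *s x)" if "i \<in> I" "x \<in> M i" for i x
    unfolding R_def using that by (intro exI[of _ "{i}"] exI[of _ "\<lambda>_. x"]) auto
  have R_total: "\<exists>z. R x z" if "x \<in> V" for x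
  proof -
    have "x \<in> span (\<Union>i\<in>I. M i)"
      using that ds by (auto simp: internal_direct_sum_def)
    then show ?thesis
    proof (induction rule: span_induct_alt)
      case base
      show ?case unfolding R_def by (intro exI[of _ 0] exI[of _ "{}"]) auto
    next
      case (step a x y)
      then show ?case using R_base R_scale R_add by blast
    qed
  qed
  define f where "f x = (THE z. R x z)" for x
  have f: "f x = z" if "R x z" for x z
    unfolding f_def using that R_unique by blast
  show ?thesis
  proof
    show "f (x + y) = f x + f y" if "x \<in> V" "y \<in> V" for x y
      using R_total that f R_add by metis
    show "f (a *s x) = a *s f x" if "x \<in> V" for a x
      using R_total that f R_scale by metis
    show "f x = c i *s x" if "i \<in> I" "x \<in> M i" for i x
      using f R_base that by blast
  qed
qed

end

context lie_algebra
begin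

lemma zero_in_L [simp]: "0 \<in> L"
  using subspace_L by (rule subspace_0)

lemma L_add [simp]: "\<lbrakk>x \<in> L; y \<in> L\<rbrakk> \<Longrightarrow> x + y \<in> L"
  using subspace_L by (rule subspace_add)

lemma L_scale [simp]: "x \<in> L \<Longrightarrow> scale a x \<in> L"
  using subspace_L by (rule subspace_scale)

lemma L_neg [simp]: "x \<in> L \<Longrightarrow> - x \<in> L"
  using subspace_L by (rule subspace_neg)

lemma L_diff [simp]: "\<lbrakk>x \<in> L; y \<in> L\<rbrakk> \<Longrightarrow> x - y \<in> L"
  using subspace_L by (rule subspace_diff)

lemma br_zero_left [simp]: "x \<in> L \<Longrightarrow> br 0 x = 0"
  using br_scale_left[of 0 x 0] by simp

lemma br_zero_right [simp]: "x \<in> L \<Longrightarrow> br x 0 = 0"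
  using br_scale_right[of x 0 0] by simp

lemma br_neg_left: "\<lbrakk>x \<in> L; y \<in> L\<rbrakk> \<Longrightarrow> br (- x) y = - br x y"
  using br_scale_left[of x y "- 1"] by simp

lemma br_neg_right: "\<lbrakk>x \<in> L; y \<in> L\<rbrakk> \<Longrightarrow> br x (- y) = - br x y"
  using br_scale_right[of x y "- 1"] by simp

lemma br_diff_left: "\<lbrakk>x \<in> L; y \<in> L; z \<in> L\<rbrakk> \<Longrightarrow> br (x - y) z = br x z - br y z"
  using br_add_left[of x "- y" z] by (simp add: br_neg_left)

lemma br_diff_right: "\<lbrakk>x \<in> L; y \<in> L; z \<in> L\<rbrakk> \<Longrightarrow> br x (y - z) = br x y - br x z"
  using br_add_right[of x y "- z"] by (simp add: br_neg_right)

lemma br_skew: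
  assumes "x \<in> L" "y \<in> L"
  shows "br y x = - br x y"
proof -
  have "br (x + y) (x + y) = br x y + br y x"
    using assms by (simp add: br_add_left br_add_right br_alternating[of x] br_alternating[of y])
  moreover have "br (x + y) (x + y) = 0"
    using assms by (intro br_alternating) simp
  ultimately show ?thesis by (metis add.commute eq_neg_iff_add_eq_0)
qed

lemma L_sum: "(\<And>i. i \<in> F \<Longrightarrow> x i \<in> L) \<Longrightarrow> (\<Sum>i\<in>F. x i) \<in> L"
  using subspace_L by (rule subspace_sum)

lemma br_sum_right:
  assumes "finite F" and "y \<in> L" and "\<And>i. i \<in> F \<Longrightarrow> x i \<in> L"
  shows "br y (\<Sum>i\<in>F. x i) = (\<Sum>i\<in>F. br y (x i))"
  using assms(1,3) by induction (auto simp: assms(2) br_add_right L_sum)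

text \<open>
  Applying \<open>ad t - \<beta> t\<close> to a vanishing sum removes the summand of weight \<open>\<beta>\<close>, and
  distinct weights differ at some \<open>t\<close> in \<open>T\<close>.
\<close>

lemma weight_vectors_independent:
  assumes T: "T \<subseteq> L"
  assumes "finite F" and "F \<subseteq> dual_on T"
    and "\<And>\<alpha>. \<alpha> \<in> F \<Longrightarrow> x \<alpha> \<in> L"
    and "\<And>\<alpha> t. \<lbrakk>\<alpha> \<in> F; t \<in> T\<rbrakk> \<Longrightarrow> br t (x \<alpha>) = scale (\<alpha> t) (x \<alpha>)"
    and "(\<Sum>\<alpha>\<in>F. x \<alpha>) = 0"
  shows "\<forall>\<alpha>\<in>F. x \<alpha> = 0"
  using assms(2-)
proof (induction F arbitrary: x)
  case empty
  then show ?case by simp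
next
  case (insert \<beta> F)
  have x\<beta>: "x \<beta> = - (\<Sum>\<alpha>\<in>F. x \<alpha>)"
    using insert by (simp add: eq_neg_iff_add_eq_0)
  have scaled_zero: "\<forall>\<alpha>\<in>F. scale (\<alpha> t - \<beta> t) (x \<alpha>) = 0" if t: "t \<in> T" for t
  proof (rule insert.IH)
    have tL: "t \<in> L" using t T by auto
    have "br t (\<Sum>\<alpha>\<in>insert \<beta> F. x \<alpha>) = (\<Sum>\<alpha>\<in>insert \<beta> F. scale (\<alpha> t) (x \<alpha>))"
      using insert.prems t tL insert.hyps by (subst br_sum_right) (auto intro!: sum.cong)
    then have "scale (\<beta> t) (x \<beta>) + (\<Sum>\<alpha>\<in>F. scale (\<alpha> t) (x \<alpha>)) = 0"
      using insert tL by simp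
    then show "(\<Sum>\<alpha>\<in>F. scale (\<alpha> t - \<beta> t) (x \<alpha>)) = 0"
      unfolding x\<beta> by (simp add: scale_left_diff_distrib sum_subtractf scale_sum_right sum_negf)
    show "br s (scale (\<alpha> t - \<beta> t) (x \<alpha>)) = scale (\<alpha> s) (scale (\<alpha> t - \<beta> t) (x \<alpha>))"
      if "\<alpha> \<in> F" "s \<in> T" for \<alpha> s
      using that insert.prems T by (subst br_scale_right) (auto simp: mult.commute)
  qed (use insert.prems in auto)
  have zero: "x \<alpha> = 0" if \<alpha>: "\<alpha> \<in> F" for \<alpha>
  proof -
    have "\<alpha> \<noteq> \<beta>" "\<alpha> \<in> dual_on T" "\<beta> \<in> dual_on T" using \<alpha> insert by auto
    moreover from this obtain t where t: "\<alpha> t \<noteq> \<beta> t" by blast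
    ultimately have "t \<in> T" by (cases "t \<in> T") (auto simp: dual_on_def)
    then show ?thesis using scaled_zero \<alpha> t by auto
  qed
  then show ?case using x\<beta> by simp
qed

lemma eigenvector_weight:
  assumes T: "subspace T" "T \<subseteq> L" and x: "x \<in> L" "x \<noteq> 0"
    and eigen: "\<And>t. t \<in> T \<Longrightarrow> \<exists>a. br t x = scale a x"
  obtains w where "w \<in> dual_on T" and "\<And>t. t \<in> T \<Longrightarrow> br t x = scale (w t) x"
proof -
  define w where "w t = (if t \<in> T then SOME a. br t x = scale a x else 0)" for t
  have w: "br t x = scale (w t) x" if "t \<in> T" for t
    using someI_ex[OF eigen[OF that]] that by (simp add: w_def)
  have w_eq: "w t = a" if "t \<in> T" "br t x = scale a x" for t a
    using w[OF that(1)] that(2) x by simp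
  have "w \<in> dual_on T"
    unfolding dual_on_def
  proof (intro CollectI conjI ballI allI impI)
    show "w (s + t) = w s + w t" if "s \<in> T" "t \<in> T" for s t
      using that T x w[of s] w[of t]
      by (intro w_eq) (auto simp: br_add_left subset_iff scale_left_distrib intro: subspace_add)
    show "w (scale c t) = c * w t" if "t \<in> T" for c t
      using that T x w[of t]
      by (intro w_eq) (auto simp: br_scale_left subset_iff intro: subspace_scale)
  qed (simp add: w_def)
  then show thesis using w that by blast
qed

lemma subspace_weight_space:
  assumes "T \<subseteq> L"
  shows "subspace {x \<in> L. \<forall>t\<in>T. br t x = scale (\<alpha> t) x}"
proof -
  have "t \<in> L" if "t \<in> T" for t using that assms by blast
  then show ?thesis
    by (auto simp: subspace_def br_add_right br_scale_right scale_right_distrib mult.commute)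
qed

lemma dual_on_add: "\<lbrakk>\<alpha> \<in> dual_on T; \<beta> \<in> dual_on T\<rbrakk> \<Longrightarrow> \<alpha> + \<beta> \<in> dual_on T"
  by (auto simp: dual_on_def algebra_simps)

lemma ad_power_in_L: "\<lbrakk>x \<in> L; y \<in> L\<rbrakk> \<Longrightarrow> (br x ^^ n) y \<in> L"
  by (induction n) (auto simp: br_closed)

lemma ad_power_add:
  "\<lbrakk>x \<in> L; y \<in> L; z \<in> L\<rbrakk> \<Longrightarrow> (br x ^^ n) (y + z) = (br x ^^ n) y + (br x ^^ n) z"
  by (induction n) (auto simp: br_add_right ad_power_in_L)

lemma ad_power_scale:
  "\<lbrakk>x \<in> L; y \<in> L\<rbrakk> \<Longrightarrow> (br x ^^ n) (scale a y) = scale a ((br x ^^ n) y)"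
  by (induction n) (auto simp: br_scale_right ad_power_in_L)

lemma lie_subalgebra_hull: "X \<subseteq> L \<Longrightarrow> lie_subalgebra (lie_subalgebra hull X)"
proof -
  assume X: "X \<subseteq> L"
  have "lie_subalgebra L"
    unfolding lie_subalgebra_def using subspace_L br_closed by blast
  then have "lie_subalgebra hull X \<subseteq> L" using X by (rule hull_minimal[rotated])
  moreover have "subspace (lie_subalgebra hull X)"
    unfolding hull_def by (intro subspace_Inter) (auto simp: lie_subalgebra_def)
  moreover have "br x y \<in> lie_subalgebra hull X"
    if "x \<in> lie_subalgebra hull X" "y \<in> lie_subalgebra hull X" for x y
    using that unfolding hull_def lie_subalgebra_def by blast
  ultimately show ?thesis by (simp add: lie_subalgebra_def)
qed

end

context toral_pair
begin

lemma root_space_zero: "0 \<in> root_space \<alpha>"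
  using subspace_T by (auto simp: root_space_def)

lemma root_space_br:
  assumes "x \<in> root_space \<alpha>" "y \<in> root_space \<beta>"
  shows "br x y \<in> root_space (\<alpha> + \<beta>)"
proof -
  have xy: "x \<in> E" "y \<in> E" using assms by (auto simp: root_space_def)
  have "br t (br x y) = scale ((\<alpha> + \<beta>) t) (br x y)" if t: "t \<in> T" for t
  proof -
    have tE: "t \<in> E" and tx: "br t x = scale (\<alpha> t) x" and ty: "br t y = scale (\<beta> t) y"
      using assms t subspace_T by (auto simp: root_space_def)
    have "br y (br t x) = - scale (\<alpha> t) (br x y)"
      using xy by (simp add: tx br_scale_right br_skew[of x y])
    moreover have "br x (br y t) = - scale (\<beta> t) (br x y)"
      using xy tE by (simp add: br_skew[of t y] ty br_neg_right br_scale_right)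
    ultimately show ?thesis
      using jacobi[OF tE xy] by (simp add: scale_left_distrib algebra_simps)
  qed
  then show ?thesis using xy br_closed by (simp add: root_space_def)
qed

text \<open>Projecting onto a root space kills every weight vector of a different weight.\<close>

lemma root_has_spanning_weight_vector:
  assumes span: "span W = E"
    and weights: "\<And>x. x \<in> W \<Longrightarrow> \<exists>\<gamma>\<in>dual_on T. x \<in> root_space \<gamma>"
    and \<beta>: "\<beta> \<in> roots"
  shows "\<exists>x\<in>W. x \<noteq> 0 \<and> x \<in> root_space \<beta>"
proof (rule ccontr)
  assume none: "\<not> ?thesis"
  obtain p where p_add: "\<And>x y. \<lbrakk>x \<in> E; y \<in> E\<rbrakk> \<Longrightarrow> p (x + y) = p x + p y"
    and p_scale: "\<And>a x. x \<in> E \<Longrightarrow> p (scale a x) = scale a (p x)"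
    and p: "\<And>\<gamma> x. \<lbrakk>\<gamma> \<in> dual_on T; x \<in> root_space \<gamma>\<rbrakk>
      \<Longrightarrow> p x = scale (if \<gamma> = \<beta> then 1 else 0) x"
  proof (rule internal_direct_sum_diagonal_map[OF root_decomposition[folded root_space_def],
        of "\<lambda>\<gamma>. if \<gamma> = \<beta> then 1 else 0"], goal_cases)
    case (1 p)
    show ?case by (rule that[OF 1(2-4)])
  qed
  have W: "p x = 0" if "x \<in> W" for x
    using weights[OF that] p none that by (cases "x = 0") fastforce+
  have "x \<in> E \<and> p x = 0" if "x \<in> span W" for x
    using that
  proof (induction rule: span_induct_alt)
    case base
    show ?case using p_scale[of 0 0] by simp
  next
    case (step c x y)
    then have "x \<in> E" using span span_base[of x W] by simp
    then show ?case using step W by (simp add: p_add p_scale)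
  qed
  moreover have "\<beta> \<in> dual_on T" "root_space \<beta> \<noteq> {0}" using \<beta> by (auto simp: roots_def)
  moreover have "root_space \<beta> \<subseteq> E" by (auto simp: root_space_def)
  ultimately show False using p[of \<beta>] span root_space_zero by fastforce
qed

end

section \<open>Locally finite root systems\<close>

context locally_finite_root_system
begin

lemma coroot_add: "\<lbrakk>\<alpha> \<in> S; \<alpha> \<noteq> 0\<rbrakk> \<Longrightarrow> coroot \<alpha> (x + y) = coroot \<alpha> x + coroot \<alpha> y"
  and coroot_scale: "\<lbrakk>\<alpha> \<in> S; \<alpha> \<noteq> 0\<rbrakk> \<Longrightarrow> coroot \<alpha> (scaleY a x) = a * coroot \<alpha> x"
  using coroot_linear[of \<alpha>] by (simp_all add: Vector_Spaces.linear_iff)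

lemma coroot_zero: "\<lbrakk>\<alpha> \<in> S; \<alpha> \<noteq> 0\<rbrakk> \<Longrightarrow> coroot \<alpha> 0 = 0"
  using coroot_scale[of \<alpha> 0 0] by simp

lemma coroot_diff: "\<lbrakk>\<alpha> \<in> S; \<alpha> \<noteq> 0\<rbrakk> \<Longrightarrow> coroot \<alpha> (x - y) = coroot \<alpha> x - coroot \<alpha> y"
  using coroot_add[of \<alpha> "x - y" y] by simp

lemma reflection_in_S:
  "\<lbrakk>\<alpha> \<in> S; \<alpha> \<noteq> 0; y \<in> S\<rbrakk> \<Longrightarrow> y - scaleY (coroot \<alpha> y) \<alpha> \<in> S"
  using reflection_S by blast

lemma uminus_in_S: "\<alpha> \<in> S \<Longrightarrow> - \<alpha> \<in> S"
proof (cases "\<alpha> = 0")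
  case False
  assume "\<alpha> \<in> S"
  moreover have "\<alpha> - scaleY 2 \<alpha> = - \<alpha>"
    using scale_left_distrib[of 1 1 \<alpha>] by simp
  ultimately show ?thesis
    using False reflection_in_S[of \<alpha> \<alpha>] by (simp add: coroot_self)
qed simp

lemma S_in_root_lattice: "\<alpha> \<in> S \<Longrightarrow> \<alpha> \<in> root_lattice"
  unfolding root_lattice_def
  by (rule module.span_base) (unfold_locales, auto simp: algebra_simps)

text \<open>
  Contradictions with local finiteness arise below from orbits of a root under products of two
  reflections, which stay in the span of finitely many roots.
\<close>

lemma no_injective_sequence_in_span:
  fixes x :: "nat \<Rightarrow> 'y"
  assumes "finite B" and "\<And>n. x n \<in> S" and "\<And>n. x n \<in> span B"
  shows "\<not> inj x"
proof
  assume "inj x"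
  moreover have "finite (S \<inter> span B)"
    using assms(1) by (auto intro!: locally_finite simp: finite_dim_subspace_def)
  ultimately show False
    using assms(2,3) finite_subset[of "range x" "S \<inter> span B"]
    by (metis IntI finite_imageD image_subsetI infinite_UNIV_nat)
qed

text \<open>
  The product of the reflections in \<open>2\<beta>\<close> and \<open>\<beta>\<close> moves \<open>y\<close> by a multiple of \<open>\<beta>\<close> that is the
  same at every iterate. Unless this multiple is zero, a root has infinitely many images.
\<close>

lemma coroot_double:
  assumes \<beta>: "\<beta> \<in> S" "\<beta> \<noteq> 0" and \<alpha>: "scaleY 2 \<beta> \<in> S"
  shows "coroot \<beta> y = 2 * coroot (scaleY 2 \<beta>) y"
proof -
  let ?\<alpha> = "scaleY 2 \<beta>"
  have \<alpha>0: "?\<alpha> \<noteq> 0" using \<beta> by simp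
  have "2 * coroot ?\<alpha> \<beta> = 2"
    using coroot_self[OF \<alpha> \<alpha>0] coroot_scale[OF \<alpha> \<alpha>0, of 2 \<beta>] by simp
  then have \<alpha>\<beta>: "coroot ?\<alpha> \<beta> = 1" by simp
  \<comment> \<open>The coefficient of the translation, which is itself invariant under translation.\<close>
  define u where "u y = coroot \<beta> y - 2 * coroot ?\<alpha> y" for y
  have u_shift: "u (y + scaleY c \<beta>) = u y" for y c
    by (simp add: u_def coroot_add[OF \<beta>] coroot_add[OF \<alpha> \<alpha>0] coroot_scale[OF \<beta>]
        coroot_scale[OF \<alpha> \<alpha>0] \<alpha>\<beta> coroot_self[OF \<beta>])
  have step: "y + scaleY (u y) \<beta> \<in> S" if "y \<in> S" for y
  proof -
    let ?z = "y - scaleY (coroot \<beta> y) \<beta>"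
    have "?z \<in> S" using that \<beta> by (simp add: reflection_in_S)
    then have "?z - scaleY (coroot ?\<alpha> ?z) ?\<alpha> \<in> S"
      by (rule reflection_in_S[OF \<alpha> \<alpha>0])
    also have "coroot ?\<alpha> ?z = coroot ?\<alpha> y - coroot \<beta> y"
      by (simp add: coroot_diff[OF \<alpha> \<alpha>0] coroot_scale[OF \<alpha> \<alpha>0] \<alpha>\<beta>)
    also have "?z - scaleY (coroot ?\<alpha> y - coroot \<beta> y) ?\<alpha> =
        y - scaleY (coroot \<beta> y + (coroot ?\<alpha> y - coroot \<beta> y) * 2) \<beta>"
      unfolding scale_left_distrib by (simp add: diff_diff_eq)
    also have "\<dots> = y + scaleY (u y) \<beta>"
      by (simp add: u_def flip: scale_minus_left)
    finally show ?thesis .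
  qed
  have "u y = 0" if y: "y \<in> S" for y
  proof (rule ccontr)
    assume u: "u y \<noteq> 0"
    define x where "x n = y + scaleY (of_nat n * u y) \<beta>" for n :: nat
    have "x n \<in> S" for n
    proof (induction n)
      case 0
      show ?case using y by (simp add: x_def)
    next
      case (Suc n)
      have "x (Suc n) = x n + scaleY (u (x n)) \<beta>"
        by (simp add: x_def u_shift scale_left_distrib algebra_simps)
      then show ?case using step Suc by simp
    qed
    moreover have "x n \<in> span {y, \<beta>}" for n
      unfolding x_def by (intro span_add span_scale span_base) auto
    moreover have "inj x"
      using u \<beta> by (auto simp: inj_def x_def)
    ultimately show False using no_injective_sequence_in_span[of "{y, \<beta>}" x] by auto
  qed
  note u_S = this
  have "y \<in> span S" using span_S by simp
  then have "u y = 0"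
  proof (induction rule: span_induct_alt)
    case base
    show ?case by (simp add: u_def coroot_zero \<alpha> \<alpha>0 \<beta>)
  next
    case (step c x y)
    then have "u x = 0" "u y = 0" using u_S by auto
    then show ?case
      by (simp add: u_def coroot_add[OF \<beta>] coroot_add[OF \<alpha> \<alpha>0] coroot_scale[OF \<beta>]
        coroot_scale[OF \<alpha> \<alpha>0])
  qed
  then show ?thesis by (simp add: u_def)
qed

text \<open>
  Divisibility stops after one step: at a quarter of \<open>\<alpha>\<close> the coroot of \<open>\<alpha>\<close> would take the
  value \<open>1/2\<close>.
\<close>

lemma half_in_S_ind:
  assumes "\<alpha> \<in> S" "\<alpha> \<notin> S_ind"
  shows "scaleY (1/2) \<alpha> \<in> S_ind" "scaleY (1/2) \<alpha> \<in> S"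
proof -
  have \<alpha>0: "\<alpha> \<noteq> 0" and half: "scaleY (1/2) \<alpha> \<in> S"
    using assms by (auto simp: S_ind_def)
  then show "scaleY (1/2) \<alpha> \<in> S" by simp
  have "scaleY (1/2) (scaleY (1/2) \<alpha>) \<notin> S"
  proof
    assume "scaleY (1/2) (scaleY (1/2) \<alpha>) \<in> S"
    then have "coroot \<alpha> (scaleY (1/2) (scaleY (1/2) \<alpha>)) \<in> \<int>"
      using assms \<alpha>0 coroot_integral by blast
    then have "(1/2 :: 'k) \<in> \<int>"
      using assms \<alpha>0 coroot_scale coroot_self by simp
    then obtain n :: int where "(1/2 :: 'k) = of_int n" by (auto elim: Ints_cases)
    then have "of_int (2 * n) = (of_int 1 :: 'k)" by (simp flip: \<open>1 / 2 = of_int n\<close>)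
    then show False by (metis of_int_eq_iff odd_one even_mult_iff even_numeral)
  qed
  then show "scaleY (1/2) \<alpha> \<in> S_ind" using half by (simp add: S_ind_def)
qed

text \<open>
  On the plane of \<open>p\<close> and \<open>q\<close> the product of the two reflections has determinant \<open>1\<close> and trace
  \<open>a b - 2\<close>. If \<open>|a b| > 4\<close>, it expands: the coordinates \<open>A\<close>, \<open>B\<close> of the
  iterates, taken with respect to the two coroots, satisfy \<open>2|A| < |b B|\<close> throughout, so that
  \<open>|A|\<close> grows strictly and the orbit of \<open>p\<close> is infinite.
\<close>

lemma coroot_product_bound:
  assumes p: "p \<in> S" "p \<noteq> 0" and q: "q \<in> S" "q \<noteq> 0"
    and a: "coroot q p = of_int a" and b: "coroot p q = of_int b"
  shows "\<bar>a * b\<bar> \<le> 4"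
proof (rule ccontr)
  assume big: "\<not> \<bar>a * b\<bar> \<le> 4"
  define sp where "sp x = x - scaleY (coroot p x) p" for x
  define sq where "sq x = x - scaleY (coroot q x) q" for x
  define x where "x n = ((\<lambda>x. sp (sq x)) ^^ n) p" for n
  have x_Suc: "x (Suc n) = sp (sq (x n))" for n by (simp add: x_def)
  have xS: "x n \<in> S" for n
    by (induction n) (auto simp: x_def sp_def sq_def reflection_in_S p q)
  have x_span: "x n \<in> span {p, q}" for n
    by (induction n) (auto simp: x_def sp_def sq_def intro!: span_diff span_scale intro: span_base)
  have "\<forall>n. \<exists>k. coroot p (x n) = of_int k" "\<forall>n. \<exists>k. coroot q (x n) = of_int k"
    using coroot_integral p q xS by (meson Ints_cases)+
  then obtain A B where A: "\<And>n. coroot p (x n) = of_int (A n)"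
    and B: "\<And>n. coroot q (x n) = of_int (B n)"
    by metis
  have A_Suc: "A (Suc n) = b * B n - A n" for n
  proof -
    have "of_int (A (Suc n)) = (of_int (b * B n - A n) :: 'k)"
      unfolding A[symmetric] of_int_diff of_int_mult B[symmetric] b[symmetric]
      by (simp add: x_Suc sp_def sq_def coroot_diff coroot_scale coroot_self p q right_diff_distrib
          mult.commute)
    then show ?thesis by (simp only: of_int_eq_iff)
  qed
  have B_Suc: "B (Suc n) = a * A (Suc n) - B n" for n
  proof -
    have "of_int (B (Suc n)) = (of_int (a * A (Suc n) - B n) :: 'k)"
      unfolding of_int_diff of_int_mult A[symmetric] B[symmetric] a[symmetric]
      by (simp add: x_Suc sp_def sq_def coroot_diff coroot_scale coroot_self p q right_diff_distrib
          mult.commute)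
    then show ?thesis by (simp only: of_int_eq_iff)
  qed
  have grow: "\<bar>A n\<bar> < \<bar>A (Suc n)\<bar>" if "2 * \<bar>A n\<bar> < \<bar>b * B n\<bar>" for n
    using that unfolding A_Suc by linarith
  have "2 * \<bar>A n\<bar> < \<bar>b * B n\<bar>" for n
  proof (induction n)
    case 0
    have "of_int (A 0) = (of_int 2 :: 'k)" "of_int (B 0) = (of_int a :: 'k)"
      unfolding A[symmetric] B[symmetric] using a by (simp_all add: x_def coroot_self p)
    then have "A 0 = 2" "B 0 = a" by (simp_all only: of_int_eq_iff)
    then show ?case using big by (simp add: mult.commute)
  next
    case (Suc n)
    have "b * B (Suc n) = (a * b) * A (Suc n) - (A (Suc n) + A n)"
      by (simp add: B_Suc A_Suc algebra_simps)
    moreover have "5 * \<bar>A (Suc n)\<bar> \<le> \<bar>(a * b) * A (Suc n)\<bar>"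
      using big unfolding abs_mult[of "a * b"] by (intro mult_right_mono) auto
    ultimately show ?case using grow[OF Suc] by linarith
  qed
  then have "strict_mono (\<lambda>n. \<bar>A n\<bar>)"
    using grow by (simp add: strict_mono_Suc_iff)
  then have "inj (\<lambda>n. \<bar>A n\<bar>)" by (rule strict_mono_imp_inj_on)
  then have "inj x"
    using A by (metis (no_types, lifting) inj_def of_int_eq_iff)
  then show False using no_injective_sequence_in_span[of "{p, q}" x] xS x_span by auto
qed

end

section \<open>The group algebra and the degree maps\<close>

definition degree_maps :: "('g::ab_group_add \<Rightarrow> 'k::field_char_0) set" where
  "degree_maps = {d. \<forall>\<mu> \<nu>. d (\<mu> + \<nu>) = d \<mu> + d \<nu>}"

text \<open>
  The dual space of \<open>degree_maps\<close>. Extension by zero makes a functional unique as a function on the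
  ambient type.
\<close>

definition degree_functionals :: "(('g::ab_group_add \<Rightarrow> 'k::field_char_0) \<Rightarrow> 'k) set" where
  "degree_functionals = {c.
     (\<forall>d\<in>degree_maps. \<forall>d'\<in>degree_maps. c (d + d') = c d + c d') \<and>
     (\<forall>a. \<forall>d\<in>degree_maps. c (\<lambda>\<mu>. a * d \<mu>) = a * c d) \<and>
     (\<forall>d. d \<notin> degree_maps \<longrightarrow> c d = 0)}"

definition degree_evaluation :: "'g::ab_group_add \<Rightarrow> ('g \<Rightarrow> 'k::field_char_0) \<Rightarrow> 'k" where
  "degree_evaluation \<mu> d = (if d \<in> degree_maps then d \<mu> else 0)"

definition finitely_supported :: "('g::ab_group_add \<Rightarrow> 'k::field_char_0) set" where
  "finitely_supported = {n. finite {\<mu>. n \<mu> \<noteq> 0}}"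

definition group_element :: "'g::ab_group_add \<Rightarrow> 'g \<Rightarrow> 'k::field_char_0" where
  "group_element \<mu> \<nu> = (if \<nu> = \<mu> then 1 else 0)"

text \<open>
  The form on the group algebra under which the group elements of \<open>\<mu>\<close> and \<open>- \<mu>\<close> are dual
  to each other.
\<close>

definition group_algebra_form ::
  "('g::ab_group_add \<Rightarrow> 'k::field_char_0) \<Rightarrow> ('g \<Rightarrow> 'k) \<Rightarrow> 'k" where
  "group_algebra_form n m = (\<Sum>\<mu> | n \<mu> \<noteq> 0. n \<mu> * m (- \<mu>))"

lemma degree_maps_closed [simp]:
  "0 \<in> degree_maps"
  "\<lbrakk>d \<in> degree_maps; d' \<in> degree_maps\<rbrakk> \<Longrightarrow> d + d' \<in> degree_maps"
  "d \<in> degree_maps \<Longrightarrow> (\<lambda>\<mu>. a * d \<mu>) \<in> degree_maps"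
  by (auto simp: degree_maps_def algebra_simps)

lemma degree_map_zero: "d \<in> degree_maps \<Longrightarrow> d 0 = 0"
  unfolding degree_maps_def by (metis (mono_tags, lifting) add_cancel_right_right mem_Collect_eq)

lemma degree_map_minus:
  assumes "d \<in> degree_maps" shows "d (- \<mu>) = - d \<mu>"
proof -
  have "d (- \<mu> + \<mu>) = d (- \<mu>) + d \<mu>"
    using assms unfolding degree_maps_def by blast
  then show ?thesis using assms by (simp add: degree_map_zero eq_neg_iff_add_eq_0)
qed

lemma degree_functionals_closed [simp]:
  "0 \<in> degree_functionals"
  "\<lbrakk>c \<in> degree_functionals; c' \<in> degree_functionals\<rbrakk> \<Longrightarrow> c + c' \<in> degree_functionals"
  "c \<in> degree_functionals \<Longrightarrow> (\<lambda>d. a * c d) \<in> degree_functionals"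
  by (auto simp: degree_functionals_def algebra_simps)

lemma degree_functional_add:
  "\<lbrakk>c \<in> degree_functionals; d \<in> degree_maps; d' \<in> degree_maps\<rbrakk> \<Longrightarrow> c (d + d') = c d + c d'"
  and degree_functional_scale:
  "\<lbrakk>c \<in> degree_functionals; d \<in> degree_maps\<rbrakk> \<Longrightarrow> c (\<lambda>\<mu>. a * d \<mu>) = a * c d"
  by (auto simp: degree_functionals_def)

lemma degree_functional_zero [simp]: "c \<in> degree_functionals \<Longrightarrow> c 0 = 0"
  using degree_functional_add[of c 0 0] by simp

lemma degree_functional_eq_0:
  "\<lbrakk>c \<in> degree_functionals; \<And>d. d \<in> degree_maps \<Longrightarrow> c d = 0\<rbrakk> \<Longrightarrow> c = 0"
  by (auto simp: degree_functionals_def fun_eq_iff)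

lemma degree_evaluation_in [simp]: "degree_evaluation \<mu> \<in> degree_functionals"
proof -
  have "d + d' \<in> degree_maps" if "d \<in> degree_maps" "d' \<in> degree_maps"
    for d d' :: "'a \<Rightarrow> 'b" using that by simp
  then show ?thesis by (auto simp: degree_functionals_def degree_evaluation_def)
qed

lemma finitely_supported_closed [simp]:
  "0 \<in> finitely_supported"
  "\<lbrakk>n \<in> finitely_supported; m \<in> finitely_supported\<rbrakk> \<Longrightarrow> n + m \<in> finitely_supported"
  "\<lbrakk>n \<in> finitely_supported; m \<in> finitely_supported\<rbrakk> \<Longrightarrow> n - m \<in> finitely_supported"
  "n \<in> finitely_supported \<Longrightarrow> (\<lambda>\<mu>. a * n \<mu>) \<in> finitely_supported"
  "n \<in> finitely_supported \<Longrightarrow> d * n \<in> finitely_supported"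
  "group_element \<mu> \<in> finitely_supported"
  unfolding finitely_supported_def
proof -
  assume n: "n \<in> {n. finite {\<mu>. n \<mu> \<noteq> 0}}"
  show "(\<lambda>\<mu>. a * n \<mu>) \<in> {n. finite {\<mu>. n \<mu> \<noteq> 0}}"
    using n by (auto elim: rev_finite_subset)
  show "d * n \<in> {n. finite {\<mu>. n \<mu> \<noteq> 0}}"
    using n by (auto elim: rev_finite_subset)
  assume m: "m \<in> {n. finite {\<mu>. n \<mu> \<noteq> 0}}"
  have "finite ({\<mu>. n \<mu> \<noteq> 0} \<union> {\<mu>. m \<mu> \<noteq> 0})" using n m by simp
  moreover have "{\<mu>. (n + m) \<mu> \<noteq> 0} \<subseteq> {\<mu>. n \<mu> \<noteq> 0} \<union> {\<mu>. m \<mu> \<noteq> 0}"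
    "{\<mu>. (n - m) \<mu> \<noteq> 0} \<subseteq> {\<mu>. n \<mu> \<noteq> 0} \<union> {\<mu>. m \<mu> \<noteq> 0}" by auto
  ultimately show "n + m \<in> {n. finite {\<mu>. n \<mu> \<noteq> 0}}" "n - m \<in> {n. finite {\<mu>. n \<mu> \<noteq> 0}}"
    by (blast intro: finite_subset)+
qed (simp_all add: group_element_def)

lemma group_algebra_form_superset:
  assumes "finite F" and "{\<mu>. n \<mu> \<noteq> 0} \<subseteq> F"
  shows "group_algebra_form n m = (\<Sum>\<mu>\<in>F. n \<mu> * m (- \<mu>))"
  unfolding group_algebra_form_def using assms by (intro sum.mono_neutral_left) auto

lemma group_algebra_form_add_left:
  assumes "n \<in> finitely_supported" "n' \<in> finitely_supported"
  shows "group_algebra_form (n + n') m = group_algebra_form n m + group_algebra_form n' m"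
proof -
  let ?F = "{\<mu>. n \<mu> \<noteq> 0} \<union> {\<mu>. n' \<mu> \<noteq> 0}"
  have "finite ?F" using assms by (simp add: finitely_supported_def)
  moreover have "{\<mu>. (n + n') \<mu> \<noteq> 0} \<subseteq> ?F" by auto
  ultimately show ?thesis
    using group_algebra_form_superset[of ?F n m] group_algebra_form_superset[of ?F n' m]
      group_algebra_form_superset[of ?F "n + n'" m]
    by (simp add: sum.distrib algebra_simps)
qed

lemma group_algebra_form_scale_left:
  "group_algebra_form (\<lambda>\<mu>. a * n \<mu>) m = a * group_algebra_form n m"
  by (cases "a = 0") (simp_all add: group_algebra_form_def sum_distrib_left mult.assoc)

lemma group_algebra_form_sym:
  assumes "n \<in> finitely_supported" "m \<in> finitely_supported"
  shows "group_algebra_form n m = group_algebra_form m n"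
proof -
  let ?F = "{\<mu>. n \<mu> \<noteq> 0} \<union> uminus ` {\<mu>. m \<mu> \<noteq> 0}"
  let ?F' = "{\<mu>. m \<mu> \<noteq> 0} \<union> uminus ` {\<mu>. n \<mu> \<noteq> 0}"
  have fin: "finite ?F" "finite ?F'" using assms by (simp_all add: finitely_supported_def)
  have F': "?F' = uminus ` ?F" by (auto simp: image_Un image_image)
  have "group_algebra_form m n = (\<Sum>\<mu>\<in>?F'. m \<mu> * n (- \<mu>))"
    using fin by (intro group_algebra_form_superset) auto
  also have "\<dots> = (\<Sum>\<mu>\<in>?F. m (- \<mu>) * n \<mu>)"
    unfolding F' by (subst sum.reindex) auto
  also have "\<dots> = group_algebra_form n m"
    using fin by (subst group_algebra_form_superset[of ?F]) (auto simp: mult.commute)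
  finally show ?thesis by simp
qed

lemma group_algebra_form_skew:
  assumes "d \<in> degree_maps" "n \<in> finitely_supported"
  shows "group_algebra_form (d * n) m = - group_algebra_form n (d * m)"
proof -
  let ?F = "{\<mu>. n \<mu> \<noteq> 0}"
  have "finite ?F" using assms by (simp add: finitely_supported_def)
  then show ?thesis
    using group_algebra_form_superset[of ?F "d * n" m] group_algebra_form_superset[of ?F n "d * m"]
    by (auto simp: degree_map_minus[OF assms(1)] sum_negf algebra_simps)
qed

lemma group_algebra_form_group_element: "group_algebra_form (group_element \<mu>) n = n (- \<mu>)"
  by (simp add: group_algebra_form_def group_element_def)

lemma mult_add_fun: "d * (n + m) = d * n + d * m" "(d + d') * n = d * n + d' * n"
  "d * (n - m) = d * n - d * m" "(\<lambda>x. a * d x) * n = (\<lambda>x. a * (d x * n x))"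
  "d * (\<lambda>x. a * n x) = (\<lambda>x. a * (d x * n x))" "d * 0 = 0"
  for d n m :: "'g::ab_group_add \<Rightarrow> 'k::field_char_0"
  by (auto simp: fun_eq_iff algebra_simps)

lemma group_algebra_form_diff_right:
  "group_algebra_form n (m - m') = group_algebra_form n m - group_algebra_form n m'"
  for n m :: "'g::ab_group_add \<Rightarrow> 'k::field_char_0"
  by (simp add: group_algebra_form_def algebra_simps sum_subtractf)

lemma group_algebra_form_zero [simp]:
  "group_algebra_form 0 n = 0" "group_algebra_form n 0 = 0" for n :: "'g::ab_group_add \<Rightarrow> 'k::field_char_0"
  by (simp_all add: group_algebra_form_def)

section \<open>Extension by degree derivations\<close>

text \<open>
  The map \<open>der d\<close> is the derivation given by the degree map \<open>d\<close>. Its skewness is what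
  makes \<open>(der d x | y)\<close> an alternating cocycle in \<open>x\<close> and \<open>y\<close>.
\<close>

locale degree_extension = lie_algebra scale L br
  for scale :: "'k::field_char_0 \<Rightarrow> 'l::ab_group_add \<Rightarrow> 'l" and L br +
  fixes \<phi> :: "'l \<Rightarrow> 'l \<Rightarrow> 'k" and der :: "('g::ab_group_add \<Rightarrow> 'k) \<Rightarrow> 'l \<Rightarrow> 'l"
  assumes form: "invariant_form \<phi>" and form_nondegenerate: "nondegenerate_on L \<phi>"
    and der_closed [simp]: "\<lbrakk>d \<in> degree_maps; x \<in> L\<rbrakk> \<Longrightarrow> der d x \<in> L"
    and der_add: "\<lbrakk>d \<in> degree_maps; x \<in> L; y \<in> L\<rbrakk> \<Longrightarrow> der d (x + y) = der d x + der d y"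
    and der_scale: "\<lbrakk>d \<in> degree_maps; x \<in> L\<rbrakk> \<Longrightarrow> der d (scale a x) = scale a (der d x)"
    and der_add_map: "\<lbrakk>d \<in> degree_maps; d' \<in> degree_maps; x \<in> L\<rbrakk>
      \<Longrightarrow> der (d + d') x = der d x + der d' x"
    and der_scale_map: "\<lbrakk>d \<in> degree_maps; x \<in> L\<rbrakk>
      \<Longrightarrow> der (\<lambda>\<mu>. a * d \<mu>) x = scale a (der d x)"
    and der_br: "\<lbrakk>d \<in> degree_maps; x \<in> L; y \<in> L\<rbrakk>
      \<Longrightarrow> der d (br x y) = br (der d x) y + br x (der d y)"
    and der_commute: "\<lbrakk>d \<in> degree_maps; d' \<in> degree_maps; x \<in> L\<rbrakk>
      \<Longrightarrow> der d (der d' x) = der d' (der d x)"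
    and der_skew: "\<lbrakk>d \<in> degree_maps; x \<in> L; y \<in> L\<rbrakk>
      \<Longrightarrow> \<phi> (der d x) y = - \<phi> x (der d y)"
begin

lemma form_add_left: "\<lbrakk>x \<in> L; y \<in> L; z \<in> L\<rbrakk> \<Longrightarrow> \<phi> (x + y) z = \<phi> x z + \<phi> y z"
  and form_scale_left: "\<lbrakk>x \<in> L; y \<in> L\<rbrakk> \<Longrightarrow> \<phi> (scale a x) y = a * \<phi> x y"
  and form_sym: "\<lbrakk>x \<in> L; y \<in> L\<rbrakk> \<Longrightarrow> \<phi> x y = \<phi> y x"
  and form_br: "\<lbrakk>x \<in> L; y \<in> L; z \<in> L\<rbrakk> \<Longrightarrow> \<phi> (br x y) z = \<phi> x (br y z)"
  using form by (auto simp: invariant_form_def symmetric_bilinear_on_def)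

lemma form_add_right: "\<lbrakk>x \<in> L; y \<in> L; z \<in> L\<rbrakk> \<Longrightarrow> \<phi> x (y + z) = \<phi> x y + \<phi> x z"
  using form_add_left[of y z x] by (simp add: form_sym[of x])

lemma form_scale_right: "\<lbrakk>x \<in> L; y \<in> L\<rbrakk> \<Longrightarrow> \<phi> x (scale a y) = a * \<phi> x y"
  using form_scale_left[of y x a] by (simp add: form_sym[of x])

lemma form_diff_left: "\<lbrakk>x \<in> L; y \<in> L; z \<in> L\<rbrakk> \<Longrightarrow> \<phi> (x - y) z = \<phi> x z - \<phi> y z"
  using form_add_left[of "x - y" y z] by simp

lemma form_diff_right: "\<lbrakk>x \<in> L; y \<in> L; z \<in> L\<rbrakk> \<Longrightarrow> \<phi> x (y - z) = \<phi> x y - \<phi> x z"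
  using form_add_right[of x "y - z" z] by simp

lemma form_zero_left [simp]: "x \<in> L \<Longrightarrow> \<phi> 0 x = 0"
  using form_scale_left[of 0 x 0] by simp

lemma form_zero_right [simp]: "x \<in> L \<Longrightarrow> \<phi> x 0 = 0"
  using form_scale_right[of x 0 0] by simp

lemma der_diff: "\<lbrakk>d \<in> degree_maps; x \<in> L; y \<in> L\<rbrakk> \<Longrightarrow> der d (x - y) = der d x - der d y"
  using der_add[of d "x - y" y] by simp

lemma der_zero [simp]: "d \<in> degree_maps \<Longrightarrow> der d 0 = 0"
  using der_scale[of d 0 0] by simp

lemma der_zero_map [simp]: "x \<in> L \<Longrightarrow> der 0 x = 0"
  using der_add_map[of 0 0 x] by simp

lemma form_der_self: "\<lbrakk>d \<in> degree_maps; x \<in> L\<rbrakk> \<Longrightarrow> \<phi> (der d x) x = 0"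
  using der_skew[of d x x] form_sym[of x "der d x"] by (simp add: eq_neg_iff_add_eq_0 flip: mult_2)

definition cocycle :: "'l \<Rightarrow> ('g \<Rightarrow> 'k) \<Rightarrow> 'l \<Rightarrow> ('g \<Rightarrow> 'k) \<Rightarrow> ('g \<Rightarrow> 'k) \<Rightarrow> 'k" where
  "cocycle l n l' n' d =
     (if d \<in> degree_maps then \<phi> (der d l) l' + group_algebra_form (d * n) n' else 0)"

fun scaleE :: "'k \<Rightarrow> ('k, 'l, 'g) reflection_ambient \<Rightarrow> ('k, 'l, 'g) reflection_ambient" where
  "scaleE a (l, n, d, c) = (scale a l, \<lambda>\<mu>. a * n \<mu>, \<lambda>\<mu>. a * d \<mu>, \<lambda>\<delta>. a * c \<delta>)"

fun brE :: "('k, 'l, 'g) reflection_ambient \<Rightarrow> ('k, 'l, 'g) reflection_ambient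
    \<Rightarrow> ('k, 'l, 'g) reflection_ambient" where
  "brE (l, n, d, c) (l', n', d', c') =
     (br l l' + der d l' - der d' l, d * n' - d' * n, 0, cocycle l n l' n')"

fun formE :: "('k, 'l, 'g) reflection_ambient \<Rightarrow> ('k, 'l, 'g) reflection_ambient \<Rightarrow> 'k" where
  "formE (l, n, d, c) (l', n', d', c') = \<phi> l l' + group_algebra_form n n' + c d' + c' d"

definition E :: "('k, 'l, 'g) reflection_ambient set" where
  "E = L \<times> finitely_supported \<times> degree_maps \<times> degree_functionals"

lemma E_iff [simp]:
  "(l, n, d, c) \<in> E \<longleftrightarrow>
    l \<in> L \<and> n \<in> finitely_supported \<and> d \<in> degree_maps \<and> c \<in> degree_functionals"
  by (simp add: E_def)

lemma cocycle_in [simp]: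
  assumes "l \<in> L" "l' \<in> L" "n \<in> finitely_supported" "n' \<in> finitely_supported"
  shows "cocycle l n l' n' \<in> degree_functionals"
proof -
  have "group_algebra_form (\<lambda>x. a * (d x * n x)) n' = a * group_algebra_form (d * n) n'" for a d
    using group_algebra_form_scale_left[of a "d * n" n'] by (simp add: times_fun_def)
  then show ?thesis using assms
    by (auto simp: degree_functionals_def cocycle_def der_add_map der_scale_map form_add_left
        form_scale_left mult_add_fun group_algebra_form_add_left algebra_simps)
qed

lemma cocycle_alternating:
  assumes "l \<in> L" "n \<in> finitely_supported"
  shows "cocycle l n l n = 0"
proof -
  have "group_algebra_form (d * n) n = 0" if "d \<in> degree_maps" for d
    using group_algebra_form_skew[OF that assms(2), of n] group_algebra_form_sym[of "d * n" n] assms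
    by (simp add: eq_neg_iff_add_eq_0 flip: mult_2)
  then show ?thesis using assms by (auto simp: fun_eq_iff cocycle_def form_der_self)
qed

lemma cocycle_skew:
  assumes "l \<in> L" "l' \<in> L" "n \<in> finitely_supported" "n' \<in> finitely_supported"
  shows "cocycle l' n' l n = - cocycle l n l' n'"
  using assms
  by (auto simp: fun_eq_iff cocycle_def der_skew form_sym[of l'] group_algebra_form_skew
      group_algebra_form_sym[of n'])

lemma cocycle_add_left:
  assumes "l1 \<in> L" "l2 \<in> L" "l' \<in> L" "n1 \<in> finitely_supported" "n2 \<in> finitely_supported"
  shows "cocycle (l1 + l2) (n1 + n2) l' n' = cocycle l1 n1 l' n' + cocycle l2 n2 l' n'"
  using assms by (auto simp: fun_eq_iff cocycle_def der_add form_add_left mult_add_fun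
      group_algebra_form_add_left)

lemma cocycle_scale_left:
  assumes "l \<in> L" "l' \<in> L"
  shows "cocycle (scale a l) (\<lambda>\<mu>. a * n \<mu>) l' n' = (\<lambda>d. a * cocycle l n l' n' d)"
proof -
  have "group_algebra_form (\<lambda>x. a * (d x * n x)) n' = a * group_algebra_form (d * n) n'" for d
    using group_algebra_form_scale_left[of a "d * n" n'] by (simp add: times_fun_def)
  then show ?thesis using assms
    by (auto simp: fun_eq_iff cocycle_def der_scale form_scale_left mult_add_fun algebra_simps)
qed

text \<open>
  The terms with a bracket cancel because \<open>der \<delta>\<close> is a derivation and the form is invariant. The
  others cancel in pairs, because the degree derivations are skew and commute.
\<close>

lemma cocycle_jacobi:
  assumes "l1 \<in> L" "l2 \<in> L" "l3 \<in> L"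
    and n: "n1 \<in> finitely_supported" "n2 \<in> finitely_supported" "n3 \<in> finitely_supported"
    and d: "d1 \<in> degree_maps" "d2 \<in> degree_maps" "d3 \<in> degree_maps"
  shows "cocycle l1 n1 (br l2 l3 + der d2 l3 - der d3 l2) (d2 * n3 - d3 * n2) +
    cocycle l2 n2 (br l3 l1 + der d3 l1 - der d1 l3) (d3 * n1 - d1 * n3) +
    cocycle l3 n3 (br l1 l2 + der d1 l2 - der d2 l1) (d1 * n2 - d2 * n1) = 0"
proof (intro ext)
  fix \<delta> :: "'g \<Rightarrow> 'k"
  \<comment> \<open>The terms with two derivations are symmetric in \<open>x\<close> and \<open>y\<close>.\<close>
  have swap: "\<phi> (der \<delta> x) (der d y) = \<phi> (der \<delta> y) (der d x)"
    if "\<delta> \<in> degree_maps" "d \<in> degree_maps" "x \<in> L" "y \<in> L" for d x y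
  proof -
    have "\<phi> (der \<delta> x) (der d y) = - \<phi> x (der d (der \<delta> y))"
      using that by (simp add: der_skew[of \<delta>] der_commute[of d \<delta>])
    also have "\<dots> = \<phi> (der d x) (der \<delta> y)" using that by (simp add: der_skew)
    also have "\<dots> = \<phi> (der \<delta> y) (der d x)" using that by (intro form_sym) auto
    finally show ?thesis .
  qed
  have swap': "group_algebra_form (\<delta> * n) (d * m) = group_algebra_form (\<delta> * m) (d * n)"
    if "\<delta> \<in> degree_maps" "d \<in> degree_maps" "n \<in> finitely_supported" "m \<in> finitely_supported"
    for d n m
  proof -
    have "group_algebra_form (\<delta> * n) (d * m) = - group_algebra_form n (d * (\<delta> * m))"
      using that by (simp add: group_algebra_form_skew[of \<delta>] mult.left_commute)
    also have "\<dots> = group_algebra_form (d * n) (\<delta> * m)"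
      using that by (simp add: group_algebra_form_skew)
    also have "\<dots> = group_algebra_form (\<delta> * m) (d * n)"
      using that by (intro group_algebra_form_sym) auto
    finally show ?thesis .
  qed
  have cyc: "\<phi> (der \<delta> l1) (br l2 l3) + \<phi> (der \<delta> l2) (br l3 l1) + \<phi> (der \<delta> l3) (br l1 l2) = 0"
    if \<delta>: "\<delta> \<in> degree_maps"
  proof -
    have "\<phi> (der \<delta> l2) (br l3 l1) = \<phi> (br l1 (der \<delta> l2)) l3"
      using assms \<delta> form_br[of l3 l1 "der \<delta> l2"] br_closed
      by (simp add: form_sym[of "der \<delta> l2"] form_sym[of l3])
    moreover have "\<phi> (der \<delta> l1) (br l2 l3) = \<phi> (br (der \<delta> l1) l2) l3"
      using assms \<delta> by (simp add: form_br)
    moreover have "\<phi> (der \<delta> l3) (br l1 l2) = - \<phi> (der \<delta> (br l1 l2)) l3"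
      using assms \<delta> br_closed by (simp add: der_skew form_sym[of l3])
    ultimately show ?thesis
      using assms \<delta> br_closed by (simp add: der_br form_add_left)
  qed
  show "(cocycle l1 n1 (br l2 l3 + der d2 l3 - der d3 l2) (d2 * n3 - d3 * n2) +
    cocycle l2 n2 (br l3 l1 + der d3 l1 - der d1 l3) (d3 * n1 - d1 * n3) +
    cocycle l3 n3 (br l1 l2 + der d1 l2 - der d2 l1) (d1 * n2 - d2 * n1)) \<delta> = 0 \<delta>"
  proof (cases "\<delta> \<in> degree_maps")
    case True
    then show ?thesis
      using assms br_closed cyc[OF True]
        swap[OF True d(2), of l1 l3] swap[OF True d(3), of l1 l2] swap[OF True d(1), of l2 l3]
        swap'[OF True d(2) n(1) n(3)] swap'[OF True d(3) n(1) n(2)] swap'[OF True d(1) n(2) n(3)]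
      by (simp add: cocycle_def form_add_right form_diff_right group_algebra_form_diff_right algebra_simps)
  qed (simp add: cocycle_def)
qed

sublocale ambient: vector_space scaleE
  by unfold_locales (auto simp: scale_right_distrib scale_left_distrib fun_eq_iff algebra_simps)

lemma brE_jacobi:
  assumes "x \<in> E" "y \<in> E" "z \<in> E"
  shows "brE x (brE y z) + brE y (brE z x) + brE z (brE x y) = 0"
proof -
  obtain l1 n1 d1 c1 where x: "x = (l1, n1, d1, c1)" by (cases x)
  obtain l2 n2 d2 c2 where y: "y = (l2, n2, d2, c2)" by (cases y)
  obtain l3 n3 d3 c3 where z: "z = (l3, n3, d3, c3)" by (cases z)
  note inE = assms[unfolded x y z E_iff]
  have "br l1 (br l2 l3 + der d2 l3 - der d3 l2) + der d1 (br l2 l3 + der d2 l3 - der d3 l2) +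
      (br l2 (br l3 l1 + der d3 l1 - der d1 l3) + der d2 (br l3 l1 + der d3 l1 - der d1 l3)) +
      (br l3 (br l1 l2 + der d1 l2 - der d2 l1) + der d3 (br l1 l2 + der d1 l2 - der d2 l1)) = 0"
    using inE jacobi[of l1 l2 l3] br_closed der_commute[of d1 d2 l3] der_commute[of d1 d3 l2]
      der_commute[of d2 d3 l1] br_skew[of "der d1 l2" l3] br_skew[of "der d2 l3" l1]
      br_skew[of "der d3 l1" l2] br_skew[of l2 "der d1 l3"] br_skew[of l3 "der d2 l1"]
      br_skew[of l1 "der d3 l2"]
    by (simp add: br_add_right br_diff_right der_add der_diff der_br algebra_simps)
  moreover have "d1 * (d2 * n3 - d3 * n2) + d2 * (d3 * n1 - d1 * n3) + d3 * (d1 * n2 - d2 * n1) = 0"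
    by (simp add: fun_eq_iff algebra_simps)
  ultimately show ?thesis
    using inE cocycle_jacobi[of l1 l2 l3 n1 n2 n3 d1 d2 d3]
    by (simp add: x y z zero_prod_def)
qed

lemma brE_closed: "\<lbrakk>x \<in> E; y \<in> E\<rbrakk> \<Longrightarrow> brE x y \<in> E"
  by (cases x; cases y) (simp add: br_closed)

lemma brE_add_left: "\<lbrakk>x \<in> E; y \<in> E; z \<in> E\<rbrakk> \<Longrightarrow> brE (x + y) z = brE x z + brE y z"
  by (cases x; cases y; cases z)
    (simp add: br_add_left der_add der_add_map mult_add_fun cocycle_add_left)

lemma brE_scale_left: "\<lbrakk>x \<in> E; y \<in> E\<rbrakk> \<Longrightarrow> brE (scaleE a x) y = scaleE a (brE x y)"
  by (cases x; cases y)
    (auto simp: br_scale_left der_scale der_scale_map mult_add_fun cocycle_scale_left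
      scale_right_distrib scale_right_diff_distrib fun_eq_iff algebra_simps)

lemma brE_skew: "\<lbrakk>x \<in> E; y \<in> E\<rbrakk> \<Longrightarrow> brE y x = - brE x y"
proof (cases x; cases y)
  fix l n d c l' n' d' c'
  assume "x \<in> E" "y \<in> E" and xy: "x = (l, n, d, c)" "y = (l', n', d', c')"
  then show ?thesis
    by (simp add: cocycle_skew[of l l' n n'] br_skew[of l l'])
qed

lemma brE_add_right:
  assumes "x \<in> E" "y \<in> E" "z \<in> E"
  shows "brE x (y + z) = brE x y + brE x z"
proof -
  have "y + z \<in> E" using assms by (cases y; cases z) simp
  then show ?thesis
    using assms brE_add_left[of y z x] by (simp add: brE_skew[of _ x])
qed

lemma brE_scale_right:
  assumes "x \<in> E" "y \<in> E"
  shows "brE x (scaleE a y) = scaleE a (brE x y)"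
proof -
  have "scaleE a y \<in> E" using assms by (cases y) simp
  then show ?thesis
    using assms brE_scale_left[of y x a] by (simp add: brE_skew[of _ x])
qed

sublocale ext: lie_algebra scaleE E brE
proof unfold_locales
  show "ambient.subspace E"
    unfolding ambient.subspace_def by (auto simp: zero_prod_def)
  show "brE x x = 0" if "x \<in> E" for x
    using that by (cases x) (simp add: cocycle_alternating br_alternating zero_prod_def)
qed (simp_all add: brE_closed brE_add_left brE_add_right brE_scale_left brE_scale_right brE_jacobi)

lemma formE_sym: "\<lbrakk>x \<in> E; y \<in> E\<rbrakk> \<Longrightarrow> formE x y = formE y x"
proof (cases x; cases y)
  fix l n d c l' n' d' c'
  assume "x \<in> E" "y \<in> E" and xy: "x = (l, n, d, c)" "y = (l', n', d', c')"
  then show ?thesis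
    by (simp add: form_sym[of l] group_algebra_form_sym[of n])
qed

lemma formE_br:
  assumes "x \<in> E" "y \<in> E" "z \<in> E"
  shows "formE (brE x y) z = formE x (brE y z)"
proof -
  obtain l1 n1 d1 c1 where x: "x = (l1, n1, d1, c1)" by (cases x)
  obtain l2 n2 d2 c2 where y: "y = (l2, n2, d2, c2)" by (cases y)
  obtain l3 n3 d3 c3 where z: "z = (l3, n3, d3, c3)" by (cases z)
  note inE = assms[unfolded x y z E_iff]
  have "\<phi> (der d2 l1) l3 = - \<phi> l1 (der d2 l3)" using inE by (simp add: der_skew)
  moreover have "\<phi> (der d3 l1) l2 = - \<phi> l1 (der d3 l2)" using inE by (simp add: der_skew)
  moreover have "group_algebra_form (d2 * n1) n3 = - group_algebra_form n1 (d2 * n3)"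
    "group_algebra_form (d3 * n1) n2 = - group_algebra_form n1 (d3 * n2)"
    using inE by (simp_all add: group_algebra_form_skew)
  moreover have "group_algebra_form (d1 * n2 - d2 * n1) n3 =
      group_algebra_form (d1 * n2) n3 - group_algebra_form (d2 * n1) n3"
    using inE group_algebra_form_add_left[of "d1 * n2 - d2 * n1" "d2 * n1" n3] by simp
  ultimately show ?thesis
    using inE br_closed by (simp add: x y z cocycle_def form_add_left form_diff_left form_add_right
      form_diff_right form_br group_algebra_form_diff_right)
qed

lemma invariant_formE: "ext.invariant_form formE"
proof -
  have "formE (x + y) z = formE x z + formE y z" if "x \<in> E" "y \<in> E" "z \<in> E" for x y z
    using that by (cases x; cases y; cases z)
      (simp add: form_add_left group_algebra_form_add_left degree_functional_add)
  moreover have "formE (scaleE a x) y = a * formE x y" if "x \<in> E" "y \<in> E" for a x y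
    using that by (cases x; cases y)
      (simp add: form_scale_left group_algebra_form_scale_left degree_functional_scale
        algebra_simps)
  ultimately show ?thesis
    unfolding ext.invariant_form_def ambient.symmetric_bilinear_on_def
    using formE_sym formE_br by blast
qed

text \<open>
  The form pairs \<open>D\<close> and \<open>C\<close> perfectly in both directions, as the evaluations belong to
  \<open>C\<close> and separate the degree maps.
\<close>

lemma formE_nondegenerate: "nondegenerate_on E formE"
  unfolding nondegenerate_on_def
proof (intro ballI impI)
  fix x assume "x \<in> E" and orth: "\<forall>y\<in>E. formE x y = 0"
  obtain l n d c where x: "x = (l, n, d, c)" by (cases x)
  have inE: "l \<in> L" "n \<in> finitely_supported" "d \<in> degree_maps" "c \<in> degree_functionals"
    using \<open>x \<in> E\<close> by (auto simp: x)
  have "\<phi> l l' = 0" if "l' \<in> L" for l'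
    using orth[rule_format, of "(l', 0, 0, 0)"] that inE by (simp add: x)
  then have "l = 0" using form_nondegenerate inE by (auto simp: nondegenerate_on_def)
  moreover have "n \<mu> = 0" for \<mu>
    using orth[rule_format, of "(0, group_element (- \<mu>), 0, 0)"] inE
      group_algebra_form_sym[of n "group_element (- \<mu>)"]
    by (simp add: x group_algebra_form_group_element)
  moreover have "c d' = 0" if "d' \<in> degree_maps" for d'
    using orth[rule_format, of "(0, 0, d', 0)"] that inE by (simp add: x)
  moreover have "d \<mu> = 0" for \<mu>
    using orth[rule_format, of "(0, 0, 0, degree_evaluation \<mu>)"] inE
    by (simp add: x degree_evaluation_def)
  ultimately show "x = 0"
    using degree_functional_eq_0[OF inE(4)] by (simp add: x zero_prod_def fun_eq_iff)
qed

end

section \<open>Degree derivations of a graded Lie algebra\<close>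

context root_lattice_graded_lie_algebra
begin

lemma lattice_closed:
  "0 \<in> root.root_lattice"
  "\<lbrakk>p \<in> root.root_lattice; q \<in> root.root_lattice\<rbrakk> \<Longrightarrow> p + q \<in> root.root_lattice"
proof -
  interpret int: module "\<lambda>n::int. scaleY (of_int n)"
    by unfold_locales (auto simp: algebra_simps)
  show "0 \<in> root.root_lattice"
    "\<lbrakk>p \<in> root.root_lattice; q \<in> root.root_lattice\<rbrakk> \<Longrightarrow> p + q \<in> root.root_lattice"
    unfolding root.root_lattice_def by (auto intro: int.span_add int.span_zero)
qed

lemma subspace_G: "q \<in> root.root_lattice \<Longrightarrow> lie.subspace (G q \<mu>)"
  using grading_sum unfolding lie.internal_direct_sum_def by fastforce

lemma G_subset: "\<lbrakk>q \<in> root.root_lattice; x \<in> G q \<mu>\<rbrakk> \<Longrightarrow> x \<in> L"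
  using grading_sum lie.span_base[of x "\<Union>i\<in>root.root_lattice \<times> UNIV. (\<lambda>(q, \<mu>). G q \<mu>) i"]
  unfolding lie.internal_direct_sum_def by auto

lemma graded_induct [consumes 1, case_names zero add homogeneous]:
  assumes x: "x \<in> L" and "P 0" and add: "\<And>x y. \<lbrakk>x \<in> L; y \<in> L; P x; P y\<rbrakk> \<Longrightarrow> P (x + y)"
    and hom: "\<And>q \<mu> x. \<lbrakk>q \<in> root.root_lattice; x \<in> G q \<mu>\<rbrakk> \<Longrightarrow> P x"
  shows "P x"
proof -
  let ?U = "\<Union>i\<in>root.root_lattice \<times> UNIV. (\<lambda>(q, \<mu>). G q \<mu>) i"
  have "x \<in> lie.span ?U"
    using x grading_sum unfolding lie.internal_direct_sum_def by blast
  then have "x \<in> L \<and> P x"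
  proof (induction rule: lie.span_induct_alt)
    case base
    show ?case using \<open>P 0\<close> by simp
  next
    case (step c x y)
    then obtain q \<mu> where q: "q \<in> root.root_lattice" "x \<in> G q \<mu>" by auto
    then have "scaleL c x \<in> G q \<mu>" using subspace_G lie.subspace_scale by blast
    then show ?case using step hom[OF q(1)] G_subset[OF q(1)] add by auto
  qed
  then show ?thesis by simp
qed

definition degree_derivation :: "('g \<Rightarrow> 'k) \<Rightarrow> 'l \<Rightarrow> 'l" where
  "degree_derivation d = (SOME D. (\<forall>x\<in>L. \<forall>y\<in>L. D (x + y) = D x + D y) \<and>
     (\<forall>a. \<forall>x\<in>L. D (scaleL a x) = scaleL a (D x)) \<and>
     (\<forall>q\<in>root.root_lattice. \<forall>\<mu>. \<forall>x\<in>G q \<mu>. D x = scaleL (d \<mu>) x))"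

lemma degree_derivation_add:
    "\<lbrakk>x \<in> L; y \<in> L\<rbrakk> \<Longrightarrow> degree_derivation d (x + y) = degree_derivation d x + degree_derivation d y"
  and degree_derivation_scale:
    "x \<in> L \<Longrightarrow> degree_derivation d (scaleL a x) = scaleL a (degree_derivation d x)"
  and degree_derivation_homogeneous:
    "\<lbrakk>q \<in> root.root_lattice; x \<in> G q \<mu>\<rbrakk> \<Longrightarrow> degree_derivation d x = scaleL (d \<mu>) x"
proof -
  obtain D where "\<And>x y. \<lbrakk>x \<in> L; y \<in> L\<rbrakk> \<Longrightarrow> D (x + y) = D x + D y"
    "\<And>a x. x \<in> L \<Longrightarrow> D (scaleL a x) = scaleL a (D x)"
    "\<And>i x. \<lbrakk>i \<in> root.root_lattice \<times> UNIV; x \<in> (\<lambda>(q, \<mu>). G q \<mu>) i\<rbrakk> \<Longrightarrow> D x = scaleL (d (snd i)) x"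
    using lie.internal_direct_sum_diagonal_map[OF grading_sum, of "\<lambda>i. d (snd i)"] by metis
  then have "\<exists>D. (\<forall>x\<in>L. \<forall>y\<in>L. D (x + y) = D x + D y) \<and>
     (\<forall>a. \<forall>x\<in>L. D (scaleL a x) = scaleL a (D x)) \<and>
     (\<forall>q\<in>root.root_lattice. \<forall>\<mu>. \<forall>x\<in>G q \<mu>. D x = scaleL (d \<mu>) x)"
    by (intro exI[of _ D]) force
  from someI_ex[OF this] show
    "\<lbrakk>x \<in> L; y \<in> L\<rbrakk> \<Longrightarrow> degree_derivation d (x + y) = degree_derivation d x + degree_derivation d y"
    "x \<in> L \<Longrightarrow> degree_derivation d (scaleL a x) = scaleL a (degree_derivation d x)"
    "\<lbrakk>q \<in> root.root_lattice; x \<in> G q \<mu>\<rbrakk> \<Longrightarrow> degree_derivation d x = scaleL (d \<mu>) x"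
    unfolding degree_derivation_def by blast+
qed

lemma degree_derivation_zero: "degree_derivation d 0 = 0"
  using degree_derivation_scale[of 0 d 0] by simp

lemma degree_derivation_in_L: "x \<in> L \<Longrightarrow> degree_derivation d x \<in> L"
  by (induction rule: graded_induct)
    (auto simp: degree_derivation_zero degree_derivation_add degree_derivation_homogeneous G_subset)

lemma degree_derivation_br:
  assumes d: "d \<in> degree_maps" and "x \<in> L" and y: "y \<in> L"
  shows "degree_derivation d (br x y) = br (degree_derivation d x) y + br x (degree_derivation d y)"
  using assms(2)
proof (induction rule: graded_induct)
  case zero
  show ?case using y by (simp add: degree_derivation_zero degree_derivation_in_L)
next
  case (add x x')
  then show ?case
    using y by (simp add: lie.br_add_left degree_derivation_add lie.br_closed degree_derivation_in_L)
next
  case (homogeneous p \<mu> x)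
  then have x: "x \<in> L" by (rule G_subset)
  show ?case
    using y
  proof (induction rule: graded_induct)
    case zero
    show ?case using x by (simp add: degree_derivation_zero degree_derivation_in_L)
  next
    case (add y y')
    then show ?case
      using x by (simp add: lie.br_add_right degree_derivation_add lie.br_closed degree_derivation_in_L)
  next
    case (homogeneous q \<nu> y)
    have "br x y \<in> G (p + q) (\<mu> + \<nu>)"
      using homogeneous \<open>p \<in> root.root_lattice\<close> \<open>x \<in> G p \<mu>\<close> by (intro grading_br)
    then show ?case
      using d homogeneous \<open>p \<in> root.root_lattice\<close> \<open>x \<in> G p \<mu>\<close> x G_subset
      by (simp add: degree_derivation_homogeneous[of "p + q" _ "\<mu> + \<nu>"] lattice_closed
          degree_derivation_homogeneous lie.br_scale_left lie.br_scale_right degree_maps_def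
          lie.scale_left_distrib)
  qed
qed

text \<open>
  Homogeneous elements pair non-trivially only in opposite \<open>\<Lambda>\<close>-degrees, and there a
  degree map takes opposite values.
\<close>

lemma degree_derivation_skew:
  assumes inv: "lie.invariant_form \<phi>"
    and graded: "\<forall>\<mu> \<nu>. \<mu> + \<nu> \<noteq> 0 \<longrightarrow> (\<forall>x\<in>Lambda_part \<mu>. \<forall>y\<in>Lambda_part \<nu>. \<phi> x y = 0)"
    and d: "d \<in> degree_maps" and "x \<in> L" and y: "y \<in> L"
  shows "\<phi> (degree_derivation d x) y = - \<phi> x (degree_derivation d y)"
proof -
  have add_left: "\<phi> (x + y) z = \<phi> x z + \<phi> y z" if "x \<in> L" "y \<in> L" "z \<in> L" for x y z
    using inv that unfolding lie.invariant_form_def lie.symmetric_bilinear_on_def by blast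
  have scale_left: "\<phi> (scaleL a x) y = a * \<phi> x y" if "x \<in> L" "y \<in> L" for x y a
    using inv that unfolding lie.invariant_form_def lie.symmetric_bilinear_on_def by blast
  have sym: "\<phi> x y = \<phi> y x" if "x \<in> L" "y \<in> L" for x y
    using inv that unfolding lie.invariant_form_def lie.symmetric_bilinear_on_def by blast
  have add_right: "\<phi> z (x + y) = \<phi> z x + \<phi> z y" if "x \<in> L" "y \<in> L" "z \<in> L" for x y z
    using add_left[OF that] that by (metis sym lie.L_add)
  have scale_right: "\<phi> y (scaleL a x) = a * \<phi> y x" if "x \<in> L" "y \<in> L" for x y a
    using scale_left[OF that] that by (metis sym lie.L_scale)
  have form_zero: "\<phi> 0 y = 0" "\<phi> y 0 = 0" if "y \<in> L" for y
    using scale_left[of 0 y 0] scale_right[of 0 y 0] that by simp_all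
  show ?thesis
    using assms(4)
  proof (induction rule: graded_induct)
    case zero
    show ?case using y by (simp add: degree_derivation_zero degree_derivation_in_L form_zero)
  next
    case (add x x')
    then show ?case
      using y by (simp add: add_left degree_derivation_add degree_derivation_in_L)
  next
    case (homogeneous p \<mu> x)
    then have x: "x \<in> L" by (rule G_subset)
    show ?case
      using y
    proof (induction rule: graded_induct)
      case zero
      show ?case using x by (simp add: degree_derivation_zero degree_derivation_in_L form_zero)
    next
      case (add y y')
      then show ?case
        using x by (simp add: add_right degree_derivation_add degree_derivation_in_L)
    next
      case (homogeneous q \<nu> y)
      have yL: "y \<in> L" using homogeneous by (rule G_subset)
      have "\<phi> x y = 0" if "\<mu> + \<nu> \<noteq> 0"
      proof -
        have "x \<in> Lambda_part \<mu>" "y \<in> Lambda_part \<nu>"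
          unfolding Lambda_part_def
          using homogeneous \<open>p \<in> root.root_lattice\<close> \<open>x \<in> G p \<mu>\<close> by (auto intro!: lie.span_base)
        then show ?thesis using graded that by blast
      qed
      moreover have "d \<nu> = - d \<mu>" if "\<mu> + \<nu> = 0"
        using degree_map_minus[OF d, of \<mu>] that by (metis minus_unique)
      ultimately show ?case
        using homogeneous \<open>p \<in> root.root_lattice\<close> \<open>x \<in> G p \<mu>\<close> x yL
        by (cases "\<mu> + \<nu> = 0") (simp_all add: degree_derivation_homogeneous scale_left
            scale_right del: lie.scale_minus_left)
    qed
  qed
qed

lemma degree_extension_degree_derivation:
  assumes inv: "lie.invariant_form \<phi>" and nondeg: "nondegenerate_on L \<phi>"
    and graded: "\<forall>\<mu> \<nu>. \<mu> + \<nu> \<noteq> 0 \<longrightarrow> (\<forall>x\<in>Lambda_part \<mu>. \<forall>y\<in>Lambda_part \<nu>. \<phi> x y = 0)"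
  shows "degree_extension scaleL L br \<phi> degree_derivation"
proof unfold_locales
  show "degree_derivation (d + d') x = degree_derivation d x + degree_derivation d' x"
    if "x \<in> L" for d d' x
    using that by (induction rule: graded_induct)
      (simp_all add: degree_derivation_zero degree_derivation_add degree_derivation_homogeneous
        lie.scale_left_distrib)
  show "degree_derivation (\<lambda>\<mu>. a * d \<mu>) x = scaleL a (degree_derivation d x)" if "x \<in> L" for a d x
    using that by (induction rule: graded_induct)
      (simp_all add: degree_derivation_zero degree_derivation_add degree_derivation_homogeneous
        lie.scale_right_distrib)
  show "degree_derivation d (degree_derivation d' x) = degree_derivation d' (degree_derivation d x)"
    if "x \<in> L" for d d' x
    using that by (induction rule: graded_induct)
      (simp_all add: degree_derivation_zero degree_derivation_add degree_derivation_in_L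
        degree_derivation_homogeneous degree_derivation_scale G_subset mult.commute)
qed (simp_all add: inv nondeg degree_derivation_in_L degree_derivation_add degree_derivation_scale
    degree_derivation_br degree_derivation_skew[OF inv graded])

end

section \<open>The torus and its roots\<close>

locale reflection_construction =
  predivision_root_graded_lie_algebra scaleL L br scaleY S coroot G
  for scaleL :: "'k::field_char_0 \<Rightarrow> 'l::ab_group_add \<Rightarrow> 'l"
    and L :: "'l set" and br :: "'l \<Rightarrow> 'l \<Rightarrow> 'l"
    and scaleY :: "'k \<Rightarrow> 'y::ab_group_add \<Rightarrow> 'y"
    and S :: "'y set" and coroot :: "'y \<Rightarrow> 'y \<Rightarrow> 'k"
    and G :: "'y \<Rightarrow> 'g::ab_group_add \<Rightarrow> 'l set" +
  fixes \<phi> :: "'l \<Rightarrow> 'l \<Rightarrow> 'k" and e f :: "'y \<Rightarrow> 'l"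
  assumes form_invariant: "lie.invariant_form \<phi>"
    and form_nondeg: "nondegenerate_on L \<phi>"
    and form_graded:
      "\<forall>\<mu> \<nu>. \<mu> + \<nu> \<noteq> 0 \<longrightarrow> (\<forall>x\<in>Lambda_part \<mu>. \<forall>y\<in>Lambda_part \<nu>. \<phi> x y = 0)"
    and inverse_pair: "\<alpha> \<in> root.S_ind - {0} \<Longrightarrow> invertible_with_inverse \<alpha> 0 (e \<alpha>) (f \<alpha>)"
    and form_nondeg_cartan:
      "nondegenerate_on (lie.span {br (e \<alpha>) (f \<alpha>) |\<alpha>. \<alpha> \<in> root.S_ind - {0}}) \<phi>"
begin

sublocale dx: degree_extension scaleL L br \<phi> degree_derivation
  using form_invariant form_nondeg form_graded by (rule degree_extension_degree_derivation)

text \<open>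
  The part of the torus inside \<open>L\<close>, on which the form is non-degenerate by assumption.
\<close>

definition cartan :: "'l set" where
  "cartan = lie.span {br (e \<alpha>) (f \<alpha>) |\<alpha>. \<alpha> \<in> root.S_ind - {0}}"

lemma G_eq_0: "\<lbrakk>q \<in> root.root_lattice; q \<notin> S; x \<in> G q \<mu>\<rbrakk> \<Longrightarrow> x = 0"
  using RG1[of q] lie.span_base[of x "\<Union>\<mu>. G q \<mu>"] unfolding root_part_def by auto

lemma G_subset_root_part: "x \<in> G q \<mu> \<Longrightarrow> x \<in> root_part q"
  unfolding root_part_def by (auto intro: lie.span_base)

lemma root_part_in_L: "q \<in> root.root_lattice \<Longrightarrow> root_part q \<subseteq> L"
  unfolding root_part_def using G_subset lie.subspace_L by (intro lie.span_minimal) auto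

lemma lattice_S: "q \<in> S \<Longrightarrow> q \<in> root.root_lattice" "q \<in> S \<Longrightarrow> - q \<in> root.root_lattice"
  using root.S_in_root_lattice root.uminus_in_S by blast+

lemma inverse_pair_facts:
  assumes "invertible_with_inverse \<alpha> \<mu> u v" "\<alpha> \<in> S"
  shows "u \<in> L" "v \<in> L" "u \<in> G \<alpha> \<mu>" "v \<in> G (- \<alpha>) (- \<mu>)" "u \<noteq> 0"
    "\<lbrakk>q \<in> root.root_lattice; x \<in> G q \<nu>\<rbrakk> \<Longrightarrow> br (br v u) x = scaleL (coroot \<alpha> q) x"
    "br v u \<in> L" "br v u \<in> G 0 0"
proof -
  show *: "u \<in> G \<alpha> \<mu>" "v \<in> G (- \<alpha>) (- \<mu>)" "u \<noteq> 0"
    "\<lbrakk>q \<in> root.root_lattice; x \<in> G q \<nu>\<rbrakk> \<Longrightarrow> br (br v u) x = scaleL (coroot \<alpha> q) x"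
    using assms G_subset_root_part by (auto simp: invertible_with_inverse_def)
  then show "u \<in> L" "v \<in> L" using assms lattice_S G_subset by blast+
  then show "br v u \<in> L" by (intro lie.br_closed)
  show "br v u \<in> G 0 0"
    using grading_br[of "- \<alpha>" \<alpha> v "- \<mu>" u \<mu>] * assms lattice_S by simp
qed

lemma invertible_exists:
  assumes "q \<in> S" "q \<noteq> 0" "x \<in> G q \<mu>" "x \<noteq> 0"
  obtains u v where "invertible_with_inverse q \<mu> u v"
proof -
  have "G q \<mu> \<noteq> {0}" using assms by blast
  then show thesis using predivision assms that unfolding invertible_def by blast
qed

text \<open>\<open>L\<close> is perfect: the Cartan elements reproduce the spaces of non-zero degree, and the
  degree zero part is spanned by brackets of those.\<close>

lemma centreless:
  assumes z: "z \<in> L" "\<And>x. x \<in> L \<Longrightarrow> br z x = 0"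
  shows "z = 0"
proof -
  have br0: "\<phi> z (br x y) = 0" if "x \<in> L" "y \<in> L" for x y
    using dx.form_br[of z x y] z that by simp
  have "\<phi> z x = 0" if "x \<in> L" for x
    using that
  proof (induction rule: graded_induct)
    case zero
    show ?case using z by simp
  next
    case (add x y)
    then show ?case using z by (simp add: dx.form_add_right)
  next
    case (homogeneous q \<mu> x)
    have xL: "x \<in> L" using homogeneous by (rule G_subset)
    consider "x = 0" | "q \<in> S" "q \<noteq> 0" "x \<noteq> 0" | "q = 0"
      using G_eq_0 homogeneous by blast
    then show ?case
    proof cases
      case 1
      then show ?thesis using z by simp
    next
      case 2
      then obtain u v where uv: "invertible_with_inverse q \<mu> u v"
        using homogeneous invertible_exists by blast
      have "br (br v u) x = scaleL 2 x"
        using inverse_pair_facts(6)[OF uv 2(1) homogeneous] 2 by (simp add: root.coroot_self)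
      moreover have "br v u \<in> L" using uv 2 inverse_pair_facts(7) by blast
      ultimately have "\<phi> z (scaleL 2 x) = 0" using br0 xL by metis
      then show ?thesis using z xL by (simp add: dx.form_scale_right)
    next
      case 3
      have "x \<in> root_part 0" using homogeneous 3 G_subset_root_part by auto
      then have "x \<in> L \<and> \<phi> z x = 0"
        unfolding RG3
      proof (induction rule: lie.span_induct_alt)
        case base
        show ?case using z by simp
      next
        case (step c x y)
        then obtain u v where "x = br u v" "u \<in> L" "v \<in> L"
          using root_part_in_L lattice_S by blast
        then show ?case
          using step z br0 by (simp add: lie.br_closed dx.form_add_right dx.form_scale_right)
      qed
      then show ?thesis by simp
    qed
  qed
  then show ?thesis using form_nondeg z by (auto simp: nondegenerate_on_def)
qed

lemma eq_if_same_action: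
  assumes "x \<in> L" "y \<in> L"
    and act: "\<And>q \<mu> z. \<lbrakk>q \<in> root.root_lattice; z \<in> G q \<mu>\<rbrakk> \<Longrightarrow> br x z = br y z"
  shows "x = y"
proof -
  have "br (x - y) z = 0" if "z \<in> L" for z
    using that
  proof (induction rule: graded_induct)
    case (homogeneous q \<mu> z)
    then show ?case using assms G_subset by (simp add: lie.br_diff_left)
  qed (use assms in \<open>simp_all add: lie.br_add_right\<close>)
  then show ?thesis using centreless[of "x - y"] assms by simp
qed

text \<open>A root outside \<open>S_ind\<close> is twice one inside, and its coroot is half of the other coroot.\<close>

lemma coroot_element_in_cartan:
  assumes uv: "invertible_with_inverse \<alpha> \<mu> u v" and \<alpha>: "\<alpha> \<in> S" "\<alpha> \<noteq> 0"
  shows "br v u \<in> cartan"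
proof -
  have ind: "br (f \<beta>) (e \<beta>) \<in> cartan" if "\<beta> \<in> root.S_ind - {0}" "\<beta> \<in> S" for \<beta>
  proof -
    have "br (f \<beta>) (e \<beta>) = - br (e \<beta>) (f \<beta>)"
      using inverse_pair_facts[OF inverse_pair] that by (intro lie.br_skew) auto
    moreover have "br (e \<beta>) (f \<beta>) \<in> cartan"
      using that unfolding cartan_def by (auto intro!: lie.span_base)
    ultimately show ?thesis unfolding cartan_def by (simp add: lie.span_neg)
  qed
  show ?thesis
  proof (cases "\<alpha> \<in> root.S_ind")
    case True
    then have pair: "invertible_with_inverse \<alpha> 0 (e \<alpha>) (f \<alpha>)"
      using inverse_pair \<alpha> by blast
    have "br v u = br (f \<alpha>) (e \<alpha>)"
    proof (rule eq_if_same_action)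
      fix q \<nu> z assume qz: "q \<in> root.root_lattice" "z \<in> G q \<nu>"
      show "br (br v u) z = br (br (f \<alpha>) (e \<alpha>)) z"
        using inverse_pair_facts(6)[OF uv \<alpha>(1) qz] inverse_pair_facts(6)[OF pair \<alpha>(1) qz] by simp
    qed (rule inverse_pair_facts(7)[OF uv \<alpha>(1)] inverse_pair_facts(7)[OF pair \<alpha>(1)])+
    then show ?thesis using ind True \<alpha> by simp
  next
    case False
    define \<beta> where "\<beta> = scaleY (1/2) \<alpha>"
    have \<beta>: "\<beta> \<in> root.S_ind - {0}" "\<beta> \<in> S" and double: "scaleY 2 \<beta> = \<alpha>"
      using root.half_in_S_ind[OF \<alpha>(1) False] \<alpha> by (simp_all add: \<beta>_def)
    note pair = inverse_pair[OF \<beta>(1)]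
    have "coroot \<beta> y = 2 * coroot \<alpha> y" for y
      using root.coroot_double[of \<beta> y] \<beta> \<alpha> by (simp add: double)
    then have half: "coroot \<alpha> y = (1/2) * coroot \<beta> y" for y by simp
    have "br v u = scaleL (1/2) (br (f \<beta>) (e \<beta>))"
    proof (rule eq_if_same_action)
      fix q \<nu> z assume qz: "q \<in> root.root_lattice" "z \<in> G q \<nu>"
      show "br (br v u) z = br (scaleL (1/2) (br (f \<beta>) (e \<beta>))) z"
        using inverse_pair_facts(6)[OF uv \<alpha>(1) qz] inverse_pair_facts(6)[OF pair \<beta>(2) qz]
          inverse_pair_facts(7)[OF pair \<beta>(2)] G_subset[OF qz]
        by (simp add: lie.br_scale_left half)
    qed (use inverse_pair_facts(7)[OF uv \<alpha>(1)] inverse_pair_facts(7)[OF pair \<beta>(2)] in simp_all)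
    then show ?thesis using ind[OF \<beta>] unfolding cartan_def by (simp add: lie.span_scale)
  qed
qed

lemma cartan_in_G: "h \<in> cartan \<Longrightarrow> h \<in> G 0 0"
proof -
  have "br (e \<alpha>) (f \<alpha>) \<in> G 0 0" if "\<alpha> \<in> root.S_ind - {0}" for \<alpha>
  proof -
    have "\<alpha> \<in> S" using that by (auto simp: root.S_ind_def)
    then show ?thesis
      using grading_br[of \<alpha> "- \<alpha>" "e \<alpha>" 0 "f \<alpha>" 0] inverse_pair_facts[OF inverse_pair] that lattice_S
      by simp
  qed
  then have "cartan \<subseteq> G 0 0"
    unfolding cartan_def by (intro lie.span_minimal subspace_G lattice_closed) auto
  then show "h \<in> cartan \<Longrightarrow> h \<in> G 0 0" by blast
qed

lemma cartan_in_L: "h \<in> cartan \<Longrightarrow> h \<in> L"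
  using cartan_in_G G_subset lattice_closed by blast

lemma der_cartan: "\<lbrakk>h \<in> cartan; d \<in> degree_maps\<rbrakk> \<Longrightarrow> degree_derivation d h = 0"
  using degree_derivation_homogeneous[OF lattice_closed(1) cartan_in_G, of h d]
  by (simp add: degree_map_zero)

text \<open>
  The spaces of degree \<open>q\<close> and \<open>- q\<close> are treated together because an invertible element and its
  inverse must get opposite weights. The scalar does not depend on \<open>\<mu>\<close>.
\<close>

lemma cartan_action:
  assumes "h \<in> cartan" and q: "q \<in> S"
  shows "\<exists>a. \<forall>\<mu>. (\<forall>x\<in>G q \<mu>. br h x = scaleL a x) \<and> (\<forall>x\<in>G (- q) \<mu>. br h x = scaleL (- a) x)"
proof -
  have "h \<in> L \<and> ?thesis"
    using assms(1) unfolding cartan_def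
  proof (induction rule: lie.span_induct_alt)
    case base
    have "br 0 x = 0" if "x \<in> G q \<mu> \<or> x \<in> G (- q) \<mu>" for x \<mu>
      using that q lattice_S G_subset by (intro lie.br_zero_left) blast
    then have "\<forall>\<mu>. (\<forall>x\<in>G q \<mu>. br 0 x = 0) \<and> (\<forall>x\<in>G (- q) \<mu>. br 0 x = 0)" by blast
    then show ?case by (auto intro!: exI[of _ 0])
  next
    case (step c g h)
    then obtain \<alpha> where \<alpha>: "g = br (e \<alpha>) (f \<alpha>)" "\<alpha> \<in> root.S_ind - {0}" "\<alpha> \<in> S"
      by (auto simp: root.S_ind_def)
    note pair = inverse_pair_facts[OF inverse_pair[OF \<alpha>(2)] \<alpha>(3)]
    have g: "g = - br (f \<alpha>) (e \<alpha>)" unfolding \<alpha> using pair by (intro lie.br_skew) auto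
    have gL: "g \<in> L" unfolding g using pair by simp
    have act: "br g x = scaleL (- coroot \<alpha> p) x" if "p \<in> root.root_lattice" "x \<in> G p \<mu>" for p x \<mu>
      unfolding g using pair that G_subset by (simp add: lie.br_neg_left)
    have cm: "coroot \<alpha> (- q) = - coroot \<alpha> q"
      using root.coroot_scale[of \<alpha> "- 1" q] \<alpha> by simp
    obtain a where a: "\<And>\<mu> x. x \<in> G q \<mu> \<Longrightarrow> br h x = scaleL a x"
      "\<And>\<mu> x. x \<in> G (- q) \<mu> \<Longrightarrow> br h x = scaleL (- a) x" using step by blast
    have "br (scaleL c g + h) x = scaleL (c * (- coroot \<alpha> q) + a) x" if "x \<in> G q \<mu>" for x \<mu>
      using that a(1)[OF that] act[OF _ that] q lattice_S G_subset[OF _ that] gL step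
      by (simp add: lie.br_add_left lie.br_scale_left lie.scale_left_diff_distrib)
    moreover have "br (scaleL c g + h) x = scaleL (- (c * (- coroot \<alpha> q) + a)) x"
      if "x \<in> G (- q) \<mu>" for x \<mu>
    proof -
      have "br (scaleL c g + h) x = scaleL (c * coroot \<alpha> q) x + scaleL (- a) x"
        using that a(2)[OF that] act[OF _ that] q lattice_S G_subset[OF _ that] gL step
        by (simp add: lie.br_add_left lie.br_scale_left cm)
      then show ?thesis by (simp flip: lie.scale_left_distrib lie.scale_minus_left)
    qed
    ultimately have "\<forall>\<mu>. (\<forall>x\<in>G q \<mu>. br (scaleL c g + h) x = scaleL (c * (- coroot \<alpha> q) + a) x) \<and>
        (\<forall>x\<in>G (- q) \<mu>. br (scaleL c g + h) x = scaleL (- (c * (- coroot \<alpha> q) + a)) x)"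
      by blast
    then have "\<exists>a. \<forall>\<mu>. (\<forall>x\<in>G q \<mu>. br (scaleL c g + h) x = scaleL a x) \<and>
        (\<forall>x\<in>G (- q) \<mu>. br (scaleL c g + h) x = scaleL (- a) x)"
      by (rule exI)
    moreover have "scaleL c g + h \<in> L" using gL step by simp
    ultimately show ?case by (rule conjI[rotated])
  qed
  then show ?thesis by simp
qed

definition T :: "('k, 'l, 'g) reflection_ambient set" where
  "T = cartan \<times> {0} \<times> degree_maps \<times> degree_functionals"

lemma T_iff [simp]: "(h, n, d, c) \<in> T \<longleftrightarrow>
    h \<in> cartan \<and> n = 0 \<and> d \<in> degree_maps \<and> c \<in> degree_functionals"
  by (simp add: T_def)

lemma T_in_E: "T \<subseteq> dx.E"
  by (auto simp: cartan_in_L)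

lemma subspace_T: "dx.ambient.subspace T"
  unfolding dx.ambient.subspace_def cartan_def
  by (auto simp: zero_prod_def T_def cartan_def fun_eq_iff lie.span_zero lie.span_add lie.span_scale)

lemma br_T:
  assumes "(h, 0, d, c) \<in> T" "(l, n, d', c') \<in> dx.E"
  shows "dx.brE (h, 0, d, c) (l, n, d', c') = (br h l + degree_derivation d l, d * n, 0, 0)"
  using assms by (auto simp: der_cartan cartan_in_L dx.cocycle_def fun_eq_iff group_algebra_form_def)

text \<open>
  A spanning set of simultaneous eigenvectors of the torus. By
  \<open>root_has_spanning_weight_vector\<close> it suffices to determine the weights of these vectors.
\<close>

definition weight_vectors :: "('k, 'l, 'g) reflection_ambient set" where
  "weight_vectors = {(x, 0, 0, 0) |x q \<mu>. q \<in> S \<and> x \<in> G q \<mu>} \<union>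
     range (\<lambda>\<mu>. (0, group_element \<mu>, 0, 0)) \<union> {0} \<times> {0} \<times> degree_maps \<times> degree_functionals"

lemma weight_vectors_in_E: "weight_vectors \<subseteq> dx.E"
proof -
  have "x \<in> L" if "q \<in> S" "x \<in> G q \<mu>" for x q \<mu>
    using that G_subset lattice_S by blast
  then show ?thesis by (auto simp: weight_vectors_def)
qed

lemma span_weight_vectors: "dx.ambient.span weight_vectors = dx.E"
proof
  show "dx.ambient.span weight_vectors \<subseteq> dx.E"
    using weight_vectors_in_E dx.ext.subspace_L by (rule dx.ambient.span_minimal)
  let ?W = "dx.ambient.span weight_vectors"
  have L: "(l, 0, 0, 0) \<in> ?W" if "l \<in> L" for l
    using that
  proof (induction rule: graded_induct)
    case zero
    show ?case using dx.ambient.span_zero[of weight_vectors] unfolding zero_prod_def .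
  next
    case (add x y)
    then show ?case using dx.ambient.span_add[of "(x, 0, 0, 0)" weight_vectors "(y, 0, 0, 0)"]
      by (simp add: zero_fun_def plus_fun_def)
  next
    case (homogeneous q \<mu> x)
    show ?case
    proof (cases "q \<in> S")
      case True
      then show ?thesis
        using homogeneous by (intro dx.ambient.span_base) (auto simp: weight_vectors_def)
    next
      case False
      then show ?thesis
        using G_eq_0[OF homogeneous(1) False homogeneous(2)] dx.ambient.span_zero[of weight_vectors]
        by (simp add: zero_prod_def zero_fun_def)
    qed
  qed
  have N: "(0, n, 0, 0) \<in> ?W" if "finite F" "{\<mu>. n \<mu> \<noteq> 0} \<subseteq> F" for F n
    using that
  proof (induction F arbitrary: n)
    case empty
    then have "n = 0" by auto
    then show ?case
      using dx.ambient.span_zero[of weight_vectors] by (simp add: zero_prod_def zero_fun_def)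
  next
    case (insert \<mu> F)
    have "(0, n(\<mu> := 0), 0, 0) \<in> ?W"
      using insert.prems by (intro insert.IH) auto
    moreover have "dx.scaleE (n \<mu>) (0, group_element \<mu>, 0, 0) \<in> ?W"
      by (intro dx.ambient.span_scale dx.ambient.span_base) (auto simp: weight_vectors_def)
    ultimately have "(0, n(\<mu> := 0), 0, 0) + dx.scaleE (n \<mu>) (0, group_element \<mu>, 0, 0) \<in> ?W"
      by (rule dx.ambient.span_add)
    moreover have "(0, n(\<mu> := 0), 0, 0) + dx.scaleE (n \<mu>) (0, group_element \<mu>, 0, 0) = (0, n, 0, 0)"
      by (auto simp: fun_eq_iff group_element_def)
    ultimately show ?case by simp
  qed
  show "dx.E \<subseteq> ?W"
  proof
    fix x assume x: "x \<in> dx.E"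
    obtain l n d c where x_eq: "x = (l, n, d, c)" by (cases x)
    have "(l, 0, 0, 0) + (0, n, 0, 0) + (0, 0, d, c) \<in> ?W"
      using x L N unfolding x_eq finitely_supported_def
      by (intro dx.ambient.span_add dx.ambient.span_base[of "(0, 0, d, c)"])
        (auto simp: weight_vectors_def finitely_supported_def)
    then show "x \<in> ?W" by (simp add: x_eq)
  qed
qed

lemma T_eigenvector:
  assumes x: "x \<in> weight_vectors" and t: "t \<in> T"
  shows "\<exists>a. dx.brE t x = dx.scaleE a x"
proof -
  obtain h d c where t_eq: "t = (h, 0, d, c)" and hT: "(h, 0, d, c) \<in> T"
    using t by (cases t) auto
  have xE: "x \<in> dx.E" using x weight_vectors_in_E by blast
  consider (L) l q \<mu> where "x = (l, 0, 0, 0)" "q \<in> S" "l \<in> G q \<mu>"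
    | (N) \<mu> where "x = (0, group_element \<mu>, 0, 0)"
    | (T) d c where "x = (0, 0, d, c)"
    using x by (auto simp: weight_vectors_def)
  then show ?thesis
  proof cases
    case L
    obtain a where a: "br h l = scaleL a l" using cartan_action[of h q] L hT by auto
    then have "dx.brE t x = dx.scaleE (a + d \<mu>) x"
      using L br_T[OF hT, of l 0 0 0] xE degree_derivation_homogeneous[of q l \<mu> d] lattice_S
      by (simp add: t_eq lie.scale_left_distrib fun_eq_iff)
    then show ?thesis ..
  next
    case N
    then have "dx.brE t x = dx.scaleE (d \<mu>) x"
      using br_T[OF hT] xE hT cartan_in_L
      by (auto simp: t_eq fun_eq_iff group_element_def degree_derivation_zero simp del: dx.brE.simps)
    then show ?thesis ..
  next
    case T
    then have "dx.brE t x = dx.scaleE 0 x"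
      using br_T[OF hT] xE hT cartan_in_L
      by (auto simp: t_eq fun_eq_iff degree_derivation_zero simp del: dx.brE.simps)
    then show ?thesis ..
  qed
qed

lemma weight_vector_weight:
  assumes x: "x \<in> weight_vectors"
  shows "\<exists>w\<in>dx.ambient.dual_on T. \<forall>t\<in>T. dx.brE t x = dx.scaleE (w t) x"
proof (cases "x = 0")
  case True
  have "(0 :: _ \<Rightarrow> 'k) \<in> dx.ambient.dual_on T" by (auto simp: dx.ambient.dual_on_def)
  moreover have "dx.brE t 0 = 0" if "t \<in> T" for t using that T_in_E by auto
  ultimately show ?thesis using True by (intro bexI[of _ 0]) auto
next
  case False
  have "x \<in> dx.E" using x weight_vectors_in_E by blast
  then obtain w where "w \<in> dx.ambient.dual_on T" "\<And>t. t \<in> T \<Longrightarrow> dx.brE t x = dx.scaleE (w t) x"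
    using dx.ext.eigenvector_weight[OF subspace_T T_in_E _ False] T_eigenvector[OF x] by metis
  then show ?thesis by blast
qed

sublocale tor: toral_pair dx.scaleE dx.E dx.brE T
proof unfold_locales
  have "(0, group_element 0, 0, 0) \<in> dx.E" by simp
  \<comment> \<open>The unit of the group algebra makes \<open>E\<close> non-zero even if \<open>L\<close> is zero.\<close>
  moreover have "group_element (0 :: 'g) \<noteq> (0 :: 'g \<Rightarrow> 'k)"
    by (auto simp: group_element_def fun_eq_iff intro!: exI[of _ 0])
  ultimately show "dx.E \<noteq> {0}" by (force simp: zero_prod_def)
  show "dx.ambient.subspace T" "T \<subseteq> dx.E" by (rule subspace_T T_in_E)+
  let ?M = "\<lambda>\<alpha>. {x \<in> dx.E. \<forall>t\<in>T. dx.brE t x = dx.scaleE (\<alpha> t) x}"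
  have sub: "dx.ambient.subspace (?M \<alpha>)" for \<alpha>
    using T_in_E by (rule dx.ext.subspace_weight_space)
  show "dx.ambient.internal_direct_sum (dx.ambient.dual_on T) ?M dx.E"
    unfolding dx.ambient.internal_direct_sum_def
  proof (intro conjI ballI allI impI)
    show "dx.ambient.subspace (?M \<alpha>)" for \<alpha> by (rule sub)
    have "weight_vectors \<subseteq> (\<Union>\<alpha>\<in>dx.ambient.dual_on T. ?M \<alpha>)"
      using weight_vector_weight weight_vectors_in_E by blast
    then have "dx.E \<subseteq> dx.ambient.span (\<Union>\<alpha>\<in>dx.ambient.dual_on T. ?M \<alpha>)"
      unfolding span_weight_vectors[symmetric] by (rule dx.ambient.span_mono)
    moreover have "dx.ambient.span (\<Union>\<alpha>\<in>dx.ambient.dual_on T. ?M \<alpha>) \<subseteq> dx.E"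
      using dx.ext.subspace_L by (intro dx.ambient.span_minimal) auto
    ultimately show "dx.ambient.span (\<Union>\<alpha>\<in>dx.ambient.dual_on T. ?M \<alpha>) = dx.E" by blast
    fix F x \<alpha>
    assume "finite F \<and> F \<subseteq> dx.ambient.dual_on T \<and> (\<forall>\<alpha>\<in>F. x \<alpha> \<in> ?M \<alpha>) \<and> (\<Sum>\<alpha>\<in>F. x \<alpha>) = 0"
      and "\<alpha> \<in> F"
    then show "x \<alpha> = 0"
      using dx.ext.weight_vectors_independent[OF T_in_E, of F x] by blast
  qed
qed

lemma cartan_closed: "0 \<in> cartan" "h \<in> cartan \<Longrightarrow> scaleL a h \<in> cartan"
  "h \<in> cartan \<Longrightarrow> - h \<in> cartan"
  unfolding cartan_def by (simp_all add: lie.span_zero lie.span_scale lie.span_neg)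

text \<open>The data attached to a root \<open>\<beta>\<close> with non-zero degree \<open>q\<close>, where \<open>a\<close> is its restriction
  to \<open>cartan\<close>.\<close>

definition root_datum where
  "root_datum \<beta> q \<mu> u v a \<longleftrightarrow> q \<in> S \<and> q \<noteq> 0 \<and> invertible_with_inverse q \<mu> u v \<and>
     (\<forall>h\<in>cartan. br h u = scaleL (a h) u \<and> br h v = scaleL (- a h) v) \<and>
     (\<forall>h d c. (h, 0, d, c) \<in> T \<longrightarrow> \<beta> (h, 0, d, c) = a h + d \<mu>)"

text \<open>
  The scalars by which \<open>cartan\<close> acts in degrees \<open>q\<close> and \<open>- q\<close> are opposite, so they vanish for
  \<open>q = 0\<close>; then only the degree map contributes to the weight.
\<close>

lemma root_cases:
  assumes \<beta>: "\<beta> \<in> tor.roots"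
  obtains (null) \<mu> where "\<And>h d c. (h, 0, d, c) \<in> T \<Longrightarrow> \<beta> (h, 0, d, c) = d \<mu>"
    | (datum) q \<mu> u v a where "root_datum \<beta> q \<mu> u v a"
proof -
  have "\<exists>x\<in>weight_vectors. x \<noteq> 0 \<and> x \<in> tor.root_space \<beta>"
    using weight_vector_weight weight_vectors_in_E
    by (intro tor.root_has_spanning_weight_vector[OF span_weight_vectors _ \<beta>])
      (auto simp: tor.root_space_def)
  then obtain x where x: "x \<in> weight_vectors" "x \<noteq> 0" and x\<beta>: "x \<in> tor.root_space \<beta>" by blast
  have eigen: "dx.brE t x = dx.scaleE (\<beta> t) x" if "t \<in> T" for t
    using x\<beta> that by (simp add: tor.root_space_def)
  have xE: "x \<in> dx.E" using x weight_vectors_in_E by blast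
  consider (L) l q \<mu> where "x = (l, 0, 0, 0)" "q \<in> S" "l \<in> G q \<mu>"
    | (N) \<mu> where "x = (0, group_element \<mu>, 0, 0)"
    | (T) d c where "x = (0, 0, d, c)"
    using x by (auto simp: weight_vectors_def)
  then show thesis
  proof cases
    case L
    have l0: "l \<noteq> 0" using L x by (auto simp: zero_prod_def)
    have "\<forall>h\<in>cartan. \<exists>a. \<forall>\<mu>. (\<forall>x\<in>G q \<mu>. br h x = scaleL a x) \<and> (\<forall>x\<in>G (- q) \<mu>. br h x = scaleL (- a) x)"
      using cartan_action L by blast
    then obtain a where a: "\<And>h x \<mu>. \<lbrakk>h \<in> cartan; x \<in> G q \<mu>\<rbrakk> \<Longrightarrow> br h x = scaleL (a h) x"
      "\<And>h x \<mu>. \<lbrakk>h \<in> cartan; x \<in> G (- q) \<mu>\<rbrakk> \<Longrightarrow> br h x = scaleL (- a h) x"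
      by metis
    have \<beta>_eq: "\<beta> (h, 0, d, c) = a h + d \<mu>" if t: "(h, 0, d, c) \<in> T" for h d c
    proof -
      have "scaleL (\<beta> (h, 0, d, c)) l = br h l + degree_derivation d l"
        using eigen[OF t] br_T[OF t, of l 0 0 0] xE L by simp
      also have "\<dots> = scaleL (a h + d \<mu>) l"
        using a(1)[of h l \<mu>] t L lattice_S degree_derivation_homogeneous[of q l \<mu> d]
        by (simp add: lie.scale_left_distrib)
      finally show ?thesis using l0 by simp
    qed
    show thesis
    proof (cases "q = 0")
      case True
      have "a h = 0" if "h \<in> cartan" for h
      proof -
        have "scaleL (a h) l = scaleL (- a h) l"
          using a[OF that, of l \<mu>] L True by simp
        then have "a h = - a h" using l0 by (simp only: lie.scale_cancel_right) simp
        then show ?thesis by (simp add: eq_neg_iff_add_eq_0 flip: mult_2)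
      qed
      then show thesis using \<beta>_eq by (intro null) auto
    next
      case False
      then obtain u v where uv: "invertible_with_inverse q \<mu> u v"
        using L l0 invertible_exists by blast
      have "root_datum \<beta> q \<mu> u v a"
        unfolding root_datum_def
        using False L uv \<beta>_eq a inverse_pair_facts(3,4)[OF uv L(2)] by blast
      then show thesis by (rule datum)
    qed
  next
    case N
    have "\<beta> (h, 0, d, c) = d \<mu>" if t: "(h, 0, d, c) \<in> T" for h d c
    proof -
      have "(\<lambda>\<nu>. \<beta> (h, 0, d, c) * group_element \<mu> \<nu>) = d * group_element \<mu>"
        using eigen[OF t] br_T[OF t] xE N by (simp del: dx.brE.simps)
      from fun_cong[OF this, of \<mu>] show ?thesis by (simp add: group_element_def)
    qed
    then show thesis by (rule null)
  next
    case T
    have "\<beta> (h, 0, d', c') = d' 0" if t: "(h, 0, d', c') \<in> T" for h d' c'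
    proof -
      have "dx.scaleE (\<beta> (h, 0, d', c')) x = 0"
        using eigen[OF t] br_T[OF t] xE T t cartan_in_L
        by (simp add: degree_derivation_zero zero_prod_def mult_add_fun del: dx.brE.simps)
      then have "\<beta> (h, 0, d', c') = 0" using x by (simp only: dx.ambient.scale_eq_0_iff) simp
      then show ?thesis using t by (simp add: degree_map_zero)
    qed
    then show thesis by (rule null)
  qed
qed

lemma root_datum_facts:
  assumes "root_datum \<beta> q \<mu> u v a"
  shows "q \<in> S" "q \<noteq> 0" "invertible_with_inverse q \<mu> u v"
    and "h \<in> cartan \<Longrightarrow> br h u = scaleL (a h) u"
    and "h \<in> cartan \<Longrightarrow> br h v = scaleL (- a h) v"
    and "(h, 0, d, c) \<in> T \<Longrightarrow> \<beta> (h, 0, d, c) = a h + d \<mu>"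
    and "u \<in> G q \<mu>" "v \<in> G (- q) (- \<mu>)" "u \<in> L" "v \<in> L" "u \<noteq> 0"
    and "br v u \<in> cartan" "br v u \<in> L" "br v u \<noteq> 0"
    and "a (br v u) = 2" "(br v u, 0, 0, 0) \<in> T" "\<beta> (br v u, 0, 0, 0) = 2"
proof -
  show *: "q \<in> S" "q \<noteq> 0" "invertible_with_inverse q \<mu> u v"
    "h \<in> cartan \<Longrightarrow> br h u = scaleL (a h) u" "h \<in> cartan \<Longrightarrow> br h v = scaleL (- a h) v"
    "(h, 0, d, c) \<in> T \<Longrightarrow> \<beta> (h, 0, d, c) = a h + d \<mu>" for h d c
    using assms by (auto simp: root_datum_def)
  note uv = inverse_pair_facts[OF *(3,1)]
  show "u \<in> G q \<mu>" "v \<in> G (- q) (- \<mu>)" "u \<in> L" "v \<in> L" "u \<noteq> 0" "br v u \<in> L"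
    using uv by auto
  show h: "br v u \<in> cartan" using coroot_element_in_cartan * by blast
  have act: "br (br v u) u = scaleL 2 u"
    using uv(6)[OF lattice_S(1)[OF *(1)] uv(3)] * by (simp add: root.coroot_self)
  show a: "a (br v u) = 2"
    using act *(4)[OF h] uv by simp
  show "br v u \<noteq> 0" using act uv by auto
  show t: "(br v u, 0, 0, 0) \<in> T" using h by simp
  show "\<beta> (br v u, 0, 0, 0) = 2" using *(6)[OF t] a by simp
qed

lemma root_datum_form:
  assumes D: "root_datum \<beta> q \<mu> u v a" and h: "h \<in> cartan"
  shows "\<phi> (br v u) h = - \<phi> v u * a h"
proof -
  note D = root_datum_facts[OF D]
  have "\<phi> (br v u) h = \<phi> v (br u h)" using D h cartan_in_L by (intro dx.form_br) auto
  also have "br u h = - scaleL (a h) u"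
    using D h cartan_in_L by (simp add: lie.br_skew[of h u])
  also have "\<phi> v (- scaleL (a h) u) = - \<phi> v u * a h"
    using D dx.form_scale_right[of v u "- a h"] by (simp add: mult.commute)
  finally show ?thesis .
qed

text \<open>
  Otherwise \<open>[v, u]\<close> would be a non-zero element of the radical of the form on \<open>cartan\<close>.
\<close>

lemma root_datum_form_nonzero:
  assumes D: "root_datum \<beta> q \<mu> u v a"
  shows "\<phi> v u \<noteq> 0"
proof
  assume "\<phi> v u = 0"
  then have "\<phi> (br v u) h = 0" if "h \<in> cartan" for h
    using root_datum_form[OF D that] by simp
  then have "br v u = 0"
    using form_nondeg_cartan root_datum_facts(12)[OF D]
    unfolding nondegenerate_on_def cartan_def by blast
  then show False using root_datum_facts(14)[OF D] by simp
qed

lemma root_datum_spaces: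
  assumes D: "root_datum \<beta> q \<mu> u v a"
  shows "(u, 0, 0, 0) \<in> tor.root_space \<beta>" "(v, 0, 0, 0) \<in> tor.root_space (- \<beta>)"
proof -
  note F = root_datum_facts[OF D]
  have "dx.brE t (u, 0, 0, 0) = dx.scaleE (\<beta> t) (u, 0, 0, 0)"
    "dx.brE t (v, 0, 0, 0) = dx.scaleE ((- \<beta>) t) (v, 0, 0, 0)" if "t \<in> T" for t
  proof -
    obtain h d c where t: "t = (h, 0, d, c)" and hT: "(h, 0, d, c) \<in> T"
      using \<open>t \<in> T\<close> by (cases t) auto
    have h: "h \<in> cartan" and d: "d \<in> degree_maps" using hT by auto
    have "degree_derivation d u = scaleL (d \<mu>) u"
      using F lattice_S by (intro degree_derivation_homogeneous) auto
    then show "dx.brE t (u, 0, 0, 0) = dx.scaleE (\<beta> t) (u, 0, 0, 0)"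
      using br_T[OF hT, of u 0 0 0] F(4)[OF h] F(6)[OF hT] F(9)
      by (simp add: t lie.scale_left_distrib fun_eq_iff)
    have "degree_derivation d v = scaleL (- d \<mu>) v"
      using F lattice_S degree_derivation_homogeneous[of "- q" v "- \<mu>" d] d
      by (simp add: degree_map_minus)
    then show "dx.brE t (v, 0, 0, 0) = dx.scaleE ((- \<beta>) t) (v, 0, 0, 0)"
      using br_T[OF hT, of v 0 0 0] F(5)[OF h] F(6)[OF hT] F(10)
      by (simp add: t lie.scale_left_diff_distrib fun_eq_iff)
  qed
  then show "(u, 0, 0, 0) \<in> tor.root_space \<beta>" "(v, 0, 0, 0) \<in> tor.root_space (- \<beta>)"
    using F by (auto simp: tor.root_space_def simp del: dx.brE.simps dx.scaleE.simps)
qed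

section \<open>Anisotropic roots\<close>

lemma nondegenerate_T: "nondegenerate_on T dx.formE"
  unfolding nondegenerate_on_def
proof (intro ballI impI)
  fix x assume "x \<in> T" and orth: "\<forall>y\<in>T. dx.formE x y = 0"
  then obtain h d c where x: "x = (h, 0, d, c)" and h: "h \<in> cartan" and d: "d \<in> degree_maps"
    and c: "c \<in> degree_functionals"
    by (cases x) auto
  have "\<phi> h h' = 0" if "h' \<in> cartan" for h'
    using orth[rule_format, of "(h', 0, 0, 0)"] that c by (simp add: x)
  then have "h = 0"
    using form_nondeg_cartan h unfolding nondegenerate_on_def cartan_def by blast
  moreover have "c d' = 0" if "d' \<in> degree_maps" for d'
    using orth[rule_format, of "(0, 0, d', 0)"] that h cartan_in_L cartan_closed by (simp add: x)
  moreover have "d \<mu> = 0" for \<mu>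
    using orth[rule_format, of "(0, 0, 0, degree_evaluation \<mu>)"] h c d cartan_in_L cartan_closed
    by (simp add: x degree_evaluation_def)
  ultimately show "x = 0"
    using degree_functional_eq_0[OF c] by (simp add: x zero_prod_def fun_eq_iff)
qed

lemma root_vector_eq:
  assumes t: "t \<in> T" "\<And>s. s \<in> T \<Longrightarrow> dx.formE t s = \<beta> s"
  shows "tor.root_vector dx.formE \<beta> = t"
  unfolding tor.root_vector_def
proof (rule the_equality)
  show "t \<in> T \<and> (\<forall>s\<in>T. dx.formE t s = \<beta> s)" using t by blast
  fix r assume r: "r \<in> T \<and> (\<forall>s\<in>T. dx.formE r s = \<beta> s)"
  have rt: "r - t \<in> T" using r t subspace_T by (intro dx.ambient.subspace_diff) auto
  have "dx.formE (r - t) s = 0" if s: "s \<in> T" for s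
  proof -
    have "r - t \<in> dx.E" "t \<in> dx.E" "s \<in> dx.E" using rt t s T_in_E by blast+
    then have "dx.formE (r - t + t) s = dx.formE (r - t) s + dx.formE t s"
      using dx.invariant_formE
      unfolding dx.ext.invariant_form_def dx.ambient.symmetric_bilinear_on_def by blast
    then show ?thesis using r t s by simp
  qed
  then have "r - t = 0" using nondegenerate_T rt by (auto simp: nondegenerate_on_def)
  then show "r = t" by simp
qed

lemma null_root_vector:
  assumes \<beta>: "\<And>h d c. (h, 0, d, c) \<in> T \<Longrightarrow> \<beta> (h, 0, d, c) = d \<mu>"
  defines "t \<equiv> (0, 0, 0, degree_evaluation \<mu>)"
  shows "t \<in> T" "\<And>s. s \<in> T \<Longrightarrow> dx.formE t s = \<beta> s" "dx.formE t t = 0"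
proof -
  show "t \<in> T" by (simp add: t_def cartan_closed)
  show "dx.formE t s = \<beta> s" if s: "s \<in> T" for s
  proof -
    obtain h d c where "s = (h, 0, d, c)" "(h, 0, d, c) \<in> T" using s by (cases s) auto
    then show ?thesis using \<beta> cartan_in_L by (simp add: t_def degree_evaluation_def)
  qed
  show "dx.formE t t = 0" by (simp add: t_def)
qed

lemma datum_root_vector:
  assumes D: "root_datum \<beta> q \<mu> u v a"
  defines "t \<equiv> (scaleL (- 1 / \<phi> v u) (br v u), 0, 0, degree_evaluation \<mu>)"
  shows "t \<in> T" "\<And>s. s \<in> T \<Longrightarrow> dx.formE t s = \<beta> s" "dx.formE t t \<noteq> 0"
proof -
  note F = root_datum_facts[OF D]
  have \<kappa>: "\<phi> v u \<noteq> 0" by (rule root_datum_form_nonzero[OF D])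
  have form: "\<phi> (scaleL (- 1 / \<phi> v u) (br v u)) h = a h" if "h \<in> cartan" for h
    using root_datum_form[OF D that] \<kappa> F(13) cartan_in_L[OF that]
    by (simp add: dx.form_scale_left del: lie.scale_minus_left)
  show "t \<in> T" using F cartan_closed by (simp add: t_def)
  show "dx.formE t s = \<beta> s" if s: "s \<in> T" for s
  proof -
    obtain h d c where s_eq: "s = (h, 0, d, c)" and hT: "(h, 0, d, c) \<in> T" using s by (cases s) auto
    then show ?thesis using F(6)[OF hT] form[of h] by (simp add: t_def degree_evaluation_def)
  qed
  have "scaleL (- 1 / \<phi> v u) (br v u) \<in> cartan" using F cartan_closed by blast
  then have "dx.formE t t = \<phi> (br v u) (scaleL (- 1 / \<phi> v u) (br v u)) * (- 1 / \<phi> v u)"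
    using F cartan_in_L by (simp add: t_def dx.form_scale_left del: lie.scale_minus_left)
  also have "\<dots> = (- 1 / \<phi> v u) * (- 1 / \<phi> v u) * (- \<phi> v u * 2)"
    using root_datum_form[OF D F(12)] F
    by (simp add: dx.form_scale_right del: lie.scale_minus_left)
  finally show "dx.formE t t \<noteq> 0" using \<kappa> by simp
qed

lemma anisotropic_iff_datum:
  assumes "\<beta> \<in> tor.roots"
  shows "\<beta> \<in> tor.anisotropic_roots dx.formE \<longleftrightarrow> (\<exists>q \<mu> u v a. root_datum \<beta> q \<mu> u v a)"
  using assms
proof (cases rule: root_cases)
  case (null \<mu>)
  have "\<not> root_datum \<beta> q \<nu> u v a" for q \<nu> u v a
    using null[of "br v u" 0 0] root_datum_facts(16,17)[of \<beta> q \<nu> u v a] by force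
  moreover have "\<beta> \<notin> tor.anisotropic_roots dx.formE"
    unfolding tor.anisotropic_roots_def
    using null_root_vector[of \<beta>, OF null] root_vector_eq[OF null_root_vector(1,2)[of \<beta>, OF null]]
    by simp
  ultimately show ?thesis by blast
next
  case (datum q \<mu> u v a)
  then have "\<beta> \<in> tor.anisotropic_roots dx.formE"
    unfolding tor.anisotropic_roots_def
    using datum_root_vector[OF datum] root_vector_eq[OF datum_root_vector(1,2)[OF datum]] assms
    by simp
  then show ?thesis using datum by blast
qed

text \<open>
  The coroot element has weight \<open>2\<close> on the root space, but maps \<open>E\<close> into \<open>L\<close>.
\<close>

lemma datum_root_space:
  assumes D: "root_datum \<beta> q \<mu> u v a" and x: "x \<in> tor.root_space \<beta>"
  shows "\<exists>l\<in>L. x = (l, 0, 0, 0)"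
proof -
  note F = root_datum_facts[OF D]
  obtain l n d c where x_eq: "x = (l, n, d, c)" by (cases x)
  have xE: "(l, n, d, c) \<in> dx.E" using x by (simp add: tor.root_space_def x_eq)
  have "(br (br v u) l, 0, 0, 0) = dx.scaleE 2 (l, n, d, c)"
    using br_T[OF F(16) xE] x F(16,17) xE unfolding tor.root_space_def x_eq
    by (simp add: mult_add_fun del: dx.brE.simps)
  then have "n = 0" "d = 0" "c = 0" by (auto simp: fun_eq_iff)
  then show ?thesis using xE by (simp add: x_eq)
qed

text \<open>A root takes a Cartan integer of \<open>S\<close> as value at a coroot element. Those are bounded by
  four, because the form makes the two Cartan integers of a pair vanish together.\<close>

lemma root_value_bound:
  assumes D: "root_datum \<beta> q \<mu> u v a" and \<gamma>: "\<gamma> \<in> tor.roots"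
  shows "\<exists>k::int. \<bar>k\<bar> \<le> 4 \<and> \<gamma> (br v u, 0, 0, 0) = of_int k"
  using \<gamma>
proof (cases rule: root_cases)
  case (null \<nu>)
  then show ?thesis using root_datum_facts(16)[OF D] by (intro exI[of _ 0]) simp
next
  case (datum p \<nu> u' v' a')
  note F = root_datum_facts[OF D] and F' = root_datum_facts[OF datum]
  have a': "a' (br v u) = coroot q p"
    using inverse_pair_facts(6)[OF F(3,1) lattice_S(1)[OF F'(1)] F'(7)] F'(4)[OF F(12)] F'(11)
    by simp
  have a: "a (br v' u') = coroot p q"
    using inverse_pair_facts(6)[OF F'(3,1) lattice_S(1)[OF F(1)] F(7)] F(4)[OF F'(12)] F(11)
    by simp
  obtain k where k: "coroot q p = of_int k" using root.coroot_integral F F' by (meson Ints_cases)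
  obtain j where j: "coroot p q = of_int j" using root.coroot_integral F F' by (meson Ints_cases)
  have "\<phi> v' u' * coroot q p = \<phi> v u * coroot p q"
    using root_datum_form[OF D F'(12)] root_datum_form[OF datum F(12)]
      dx.form_sym[OF F(13) F'(13)] a a' by simp
  then have "j = 0 \<Longrightarrow> k = 0" using root_datum_form_nonzero[OF datum] by (simp add: k j)
  moreover have "\<bar>k * j\<bar> \<le> 4" using root.coroot_product_bound F(1,2) F'(1,2) k j by blast
  moreover have "\<bar>k\<bar> \<le> \<bar>k * j\<bar>" if "j \<noteq> 0"
    using that mult_left_mono[of 1 "\<bar>j\<bar>" "\<bar>k\<bar>"] by (simp add: abs_mult)
  ultimately have "\<bar>k\<bar> \<le> 4" by (cases "j = 0") auto
  then show ?thesis using F'(6)[OF F(16)] a' k by auto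
qed

text \<open>
  A weight with value \<open>k\<close> at the coroot element of \<open>\<beta>\<close> has value \<open>k + 10\<close> after five steps, and
  both cannot lie between \<open>- 4\<close> and \<open>4\<close>.
\<close>

lemma ad_fifth_power:
  assumes D: "root_datum \<beta> q \<mu> u v a" and \<beta>: "\<beta> \<in> tor.roots"
    and x: "x \<in> tor.root_space \<beta>" and y: "y \<in> dx.E"
  shows "(dx.brE x ^^ 5) y = 0"
proof -
  note F = root_datum_facts[OF D]
  have xE: "x \<in> dx.E" using x by (simp add: tor.root_space_def)
  have power: "(dx.brE x ^^ n) z \<in> tor.root_space (\<gamma> + of_nat n * \<beta>)"
    if "z \<in> tor.root_space \<gamma>" for n z \<gamma>
  proof (induction n)
    case 0
    show ?case using that by simp
  next
    case (Suc n)
    have eq: "\<gamma> + of_nat (Suc n) * \<beta> = \<beta> + (\<gamma> + of_nat n * \<beta>)" by (simp add: algebra_simps)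
    show ?case
      using tor.root_space_br[OF x Suc] unfolding eq by (simp only: funpow.simps comp_apply)
  qed
  have vanish: "(dx.brE x ^^ 5) z = 0" if z: "z \<in> tor.root_space \<gamma>" "\<gamma> \<in> dx.ambient.dual_on T" for z \<gamma>
  proof (rule ccontr)
    assume nz: "(dx.brE x ^^ 5) z \<noteq> 0"
    have "z \<noteq> 0" using nz dx.ext.ad_power_scale[OF xE, of 0 5 0] by auto
    then have "\<gamma> \<in> tor.roots" using z by (auto simp: tor.roots_def)
    then obtain k :: int where k: "\<bar>k\<bar> \<le> 4" "\<gamma> (br v u, 0, 0, 0) = of_int k"
      using root_value_bound[OF D] by blast
    \<comment> \<open>A repeated sum makes closure of the dual space under addition applicable.\<close>
    have sum: "\<gamma> + of_nat 5 * \<beta> = \<gamma> + (\<beta> + \<beta> + \<beta> + \<beta> + \<beta>)" by (simp add: fun_eq_iff)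
    have "\<gamma> + of_nat 5 * \<beta> \<in> dx.ambient.dual_on T"
      unfolding sum using z \<beta> by (intro dx.ext.dual_on_add) (auto simp: tor.roots_def)
    then have "\<gamma> + of_nat 5 * \<beta> \<in> tor.roots"
      using power[OF z(1), of 5] nz by (auto simp: tor.roots_def)
    then obtain j :: int where j: "\<bar>j\<bar> \<le> 4" "(\<gamma> + of_nat 5 * \<beta>) (br v u, 0, 0, 0) = of_int j"
      using root_value_bound[OF D] by blast
    have "of_int (k + 10) = (of_int j :: 'k)"
      using j(2) k(2) F(17) by simp
    then have "k + 10 = j" by (simp only: of_int_eq_iff)
    then show False using k(1) j(1) by linarith
  qed
  have "y \<in> dx.ambient.span (\<Union>\<gamma>\<in>dx.ambient.dual_on T. tor.root_space \<gamma>)"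
    using y tor.root_decomposition[folded tor.root_space_def]
    by (simp add: dx.ambient.internal_direct_sum_def)
  then have "y \<in> dx.E \<and> (dx.brE x ^^ 5) y = 0"
  proof (induction rule: dx.ambient.span_induct_alt)
    case base
    show ?case using dx.ext.ad_power_scale[OF xE, of 0 5 0] by simp
  next
    case (step c z y)
    then obtain \<gamma> where "\<gamma> \<in> dx.ambient.dual_on T" "z \<in> tor.root_space \<gamma>" by blast
    then have "(dx.brE x ^^ 5) z = 0" and "z \<in> dx.E"
      using vanish by (blast, simp only: tor.root_space_def mem_Collect_eq)
    then show ?case
      using step xE by (simp only: dx.ext.ad_power_add dx.ext.ad_power_scale dx.ext.L_scale
          dx.ext.L_add) simp
  qed
  then show ?thesis by simp
qed

sublocale iara: invariant_affine_reflection_algebra dx.scaleE dx.E dx.brE T dx.formE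
proof unfold_locales
  show "dx.ext.invariant_form dx.formE" by (rule dx.invariant_formE)
  show "nondegenerate_on dx.E dx.formE" by (rule dx.formE_nondegenerate)
  show "nondegenerate_on T dx.formE" by (rule nondegenerate_T)
  show "\<exists>t\<in>T. \<forall>s\<in>T. dx.formE t s = \<beta> s" if "\<beta> \<in> tor.roots" for \<beta>
    using that
  proof (cases rule: root_cases)
    case (null \<mu>)
    then show ?thesis using null_root_vector(1,2)[of \<beta>, OF null] by blast
  next
    case (datum q \<mu> u v a)
    then show ?thesis using datum_root_vector(1,2)[OF datum] by blast
  qed
  show "\<exists>x\<in>tor.root_space \<beta>. \<exists>y\<in>tor.root_space (- \<beta>). dx.brE x y \<noteq> 0 \<and> dx.brE x y \<in> T"
    if \<beta>: "\<beta> \<in> tor.roots" "\<beta> \<noteq> 0" for \<beta>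
    using \<beta>(1)
  proof (cases rule: root_cases)
    case (null \<mu>)
    obtain t where "\<beta> t \<noteq> 0" using \<beta>(2) by (auto simp: fun_eq_iff)
    moreover have "\<beta> \<in> dx.ambient.dual_on T" using \<beta>(1) by (simp add: tor.roots_def)
    ultimately have "\<beta> t \<noteq> 0" "t \<in> T" unfolding dx.ambient.dual_on_def by blast+
    moreover obtain h n d c where t: "t = (h, n, d, c)" by (cases t)
    ultimately have d: "d \<mu> \<noteq> 0" "d \<in> degree_maps" using null[of h d c] by auto
    \<comment> \<open>The bracket of opposite group elements is a pure cocycle value.\<close>
    let ?x = "(0, group_element \<mu>, 0, 0)" and ?y = "(0, group_element (- \<mu>), 0, 0)"
    have weight: "dx.brE t (0, group_element \<nu>, 0, 0) = dx.scaleE (d \<nu>) (0, group_element \<nu>, 0, 0)"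
      if "t = (h, 0, d, c)" "t \<in> T" for t h d c \<nu>
      using br_T[of h d c 0 "group_element \<nu>" 0 0] that cartan_in_L
      by (auto simp: fun_eq_iff group_element_def degree_derivation_zero simp del: dx.brE.simps)
    have "?x \<in> tor.root_space \<beta>"
      unfolding tor.root_space_def
    proof (intro CollectI conjI ballI)
      fix t assume t: "t \<in> T"
      then obtain h d c where t': "t = (h, 0, d, c)" by (cases t) auto
      then show "dx.brE t ?x = dx.scaleE (\<beta> t) ?x" using weight[OF t' t, of \<mu>] null t by simp
    qed simp
    moreover have "?y \<in> tor.root_space (- \<beta>)"
      unfolding tor.root_space_def
    proof (intro CollectI conjI ballI)
      fix t assume t: "t \<in> T"
      then obtain h d c where t': "t = (h, 0, d, c)" by (cases t) auto
      then have "d (- \<mu>) = (- \<beta>) t" using t null by (auto simp: degree_map_minus)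
      then show "dx.brE t ?y = dx.scaleE ((- \<beta>) t) ?y" using weight[OF t' t, of "- \<mu>"] by simp
    qed simp
    moreover have "dx.brE ?x ?y = (0, 0, 0, degree_evaluation \<mu>)"
    proof -
      have "group_algebra_form (\<delta> * group_element \<mu>) (group_element (- \<mu>)) = \<delta> \<mu>" for \<delta> :: "'g \<Rightarrow> 'k"
      proof -
        have "\<delta> * group_element \<mu> = (\<lambda>\<nu>. \<delta> \<mu> * group_element \<mu> \<nu>)"
          by (auto simp: fun_eq_iff group_element_def)
        then show ?thesis
          by (simp add: group_algebra_form_scale_left group_algebra_form_group_element)
            (simp add: group_element_def)
      qed
      then show ?thesis
        by (auto simp: dx.cocycle_def fun_eq_iff degree_evaluation_def)
    qed
    moreover have "(0, 0, 0, degree_evaluation \<mu>) \<noteq> (0 :: ('k, 'l, 'g) reflection_ambient)"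
      using d by (auto simp: zero_prod_def fun_eq_iff degree_evaluation_def intro!: exI[of _ d])
    moreover have "(0, 0, 0, degree_evaluation \<mu>) \<in> T" by (simp add: cartan_closed)
    ultimately show ?thesis by metis
  next
    case (datum q \<mu> u v a)
    note F = root_datum_facts[OF datum]
    have uv: "br u v = - br v u" using F by (intro lie.br_skew) auto
    have "dx.brE (u, 0, 0, 0) (v, 0, 0, 0) \<in> T" "dx.brE (u, 0, 0, 0) (v, 0, 0, 0) \<noteq> 0"
      using F uv cartan_closed by (auto simp: zero_prod_def)
    then show ?thesis using root_datum_spaces[OF datum] by blast
  qed
  show "\<exists>n. (dx.brE x ^^ n) y = 0"
    if an: "\<beta> \<in> tor.anisotropic_roots dx.formE" and x: "x \<in> tor.root_space \<beta>" and y: "y \<in> dx.E"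
    for \<beta> x y
  proof -
    have \<beta>: "\<beta> \<in> tor.roots" using an by (simp add: tor.anisotropic_roots_def)
    then obtain q \<mu> u v a where "root_datum \<beta> q \<mu> u v a" using an anisotropic_iff_datum by blast
    then show ?thesis using ad_fifth_power[OF _ \<beta> x y] by blast
  qed
qed

section \<open>The core and its centre\<close>

definition core :: "('k, 'l, 'g) reflection_ambient set" where
  "core = tor.core dx.formE"

lemma lie_subalgebra_core: "dx.ext.lie_subalgebra core"
  unfolding core_def tor.core_def
  by (rule dx.ext.lie_subalgebra_hull) (auto simp: tor.root_space_def)

lemma core_in_E: "core \<subseteq> dx.E" and subspace_core: "dx.ambient.subspace core"
    and core_br: "\<lbrakk>x \<in> core; y \<in> core\<rbrakk> \<Longrightarrow> dx.brE x y \<in> core"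
  using lie_subalgebra_core by (auto simp: dx.ext.lie_subalgebra_def)

text \<open>Anisotropic root spaces lie in \<open>L\<close>, whose brackets only leave it through the cocycle.\<close>

lemma core_shape: "(l, n, d, c) \<in> core \<Longrightarrow> n = 0 \<and> d = 0"
proof -
  let ?A = "L \<times> {0} \<times> {0} \<times> degree_functionals :: ('k, 'l, 'g) reflection_ambient set"
  have "dx.ambient.subspace ?A"
    by (auto simp: dx.ambient.subspace_def zero_prod_def fun_eq_iff)
  moreover have "dx.brE x y \<in> ?A" if "x \<in> ?A" "y \<in> ?A" for x y
    using that by (auto simp: lie.br_closed)
  moreover have "?A \<subseteq> dx.E" by auto
  ultimately have "dx.ext.lie_subalgebra ?A" by (simp add: dx.ext.lie_subalgebra_def)
  moreover have "tor.root_space \<beta> \<subseteq> ?A" if an: "\<beta> \<in> tor.anisotropic_roots dx.formE" for \<beta>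
  proof -
    have "\<beta> \<in> tor.roots" using an by (simp add: tor.anisotropic_roots_def)
    then obtain q \<mu> u v a where "root_datum \<beta> q \<mu> u v a" using an anisotropic_iff_datum by blast
    then show ?thesis using datum_root_space by fastforce
  qed
  ultimately have "core \<subseteq> ?A"
    unfolding core_def tor.core_def by (intro hull_minimal) auto
  then show "(l, n, d, c) \<in> core \<Longrightarrow> n = 0 \<and> d = 0" by auto
qed

lemma homogeneous_in_core:
  assumes q: "q \<in> S" "q \<noteq> 0" and x: "x \<in> G q \<mu>"
  shows "(x, 0, 0, 0) \<in> core"
proof (cases "x = 0")
  case True
  then show ?thesis using dx.ambient.subspace_0[OF subspace_core] by (simp add: zero_prod_def)
next
  case False
  have "(x, 0, 0, 0) \<in> weight_vectors" using q x by (auto simp: weight_vectors_def)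
  then obtain w where w: "w \<in> dx.ambient.dual_on T"
    and wx: "\<And>t. t \<in> T \<Longrightarrow> dx.brE t (x, 0, 0, 0) = dx.scaleE (w t) (x, 0, 0, 0)"
    using weight_vector_weight by blast
  have xL: "x \<in> L" using G_subset lattice_S q x by blast
  then have x_space: "(x, 0, 0, 0) \<in> tor.root_space w"
    using wx by (simp add: tor.root_space_def del: dx.brE.simps dx.scaleE.simps)
  then have root: "w \<in> tor.roots" using w False by (auto simp: tor.roots_def zero_prod_def)
  obtain u v where uv: "invertible_with_inverse q \<mu> u v"
    using invertible_exists[OF q x False] by blast
  have h: "(br v u, 0, 0, 0) \<in> T" using coroot_element_in_cartan[OF uv q] by simp
  have "br (br v u) x = scaleL 2 x"
    using inverse_pair_facts(6)[OF uv q(1) lattice_S(1)[OF q(1)] x] q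
    by (simp add: root.coroot_self)
  then have w2: "w (br v u, 0, 0, 0) = 2"
    using wx[OF h] br_T[OF h, of x 0 0 0] xL False by simp
  have "\<exists>q \<mu> u v a. root_datum w q \<mu> u v a"
    using root
  proof (cases rule: root_cases)
    case (null \<nu>)
    then show ?thesis using null[OF h] w2 by simp
  qed blast
  then have "w \<in> tor.anisotropic_roots dx.formE" using root anisotropic_iff_datum by blast
  then show ?thesis unfolding core_def tor.core_def using x_space by (intro hull_inc) blast
qed

text \<open>
  The image of the core in \<open>L\<close> is a subalgebra with all spaces of non-zero root degree, hence also
  contains the degree zero part, which is spanned by their brackets.
\<close>

lemma core_projection: "l \<in> L \<Longrightarrow> \<exists>c. (l, 0, 0, c) \<in> core"
proof -
  define P where "P = {l \<in> L. \<exists>c. (l, 0, 0, c) \<in> core}"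
  have P_br: "br x y \<in> P" if xy: "x \<in> P" "y \<in> P" for x y
  proof -
    obtain c c' where "(x, 0, 0, c) \<in> core" "(y, 0, 0, c') \<in> core"
      using xy by (auto simp: P_def)
    from core_br[OF this] show ?thesis
      using xy by (auto simp: P_def lie.br_closed)
  qed
  have P_add: "x + y \<in> P" if xy: "x \<in> P" "y \<in> P" for x y
  proof -
    obtain c c' where "(x, 0, 0, c) \<in> core" "(y, 0, 0, c') \<in> core"
      using xy by (auto simp: P_def)
    from dx.ambient.subspace_add[OF subspace_core this] show ?thesis
      using xy by (auto simp: P_def)
  qed
  have P_scale: "scaleL a x \<in> P" if x: "x \<in> P" for x a
  proof -
    obtain c where "(x, 0, 0, c) \<in> core" using x by (auto simp: P_def)
    from dx.ambient.subspace_scale[OF subspace_core this, of a] show ?thesis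
      using x by (auto simp: P_def zero_fun_def)
  qed
  have P0: "0 \<in> P"
    using dx.ambient.subspace_0[OF subspace_core] by (auto simp: P_def zero_prod_def)
  have sub: "lie.subspace P" using P_add P_scale P0 by (simp add: lie.subspace_def)
  have hom: "x \<in> P" if "q \<in> S" "q \<noteq> 0" "x \<in> G q \<mu>" for q \<mu> x
    using homogeneous_in_core[OF that] G_subset[OF lattice_S(1) that(3)] that by (auto simp: P_def)
  have part: "root_part q \<subseteq> P" if "q \<in> S" "q \<noteq> 0" for q
    unfolding root_part_def using hom that sub by (intro lie.span_minimal) auto
  have "br x y \<in> P" if "\<alpha> \<in> S - {0}" "x \<in> root_part \<alpha>" "y \<in> root_part (- \<alpha>)" for \<alpha> x y
    using that part[of \<alpha>] part[of "- \<alpha>"] root.uminus_in_S by (intro P_br) auto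
  then have part0: "root_part 0 \<subseteq> P"
    unfolding RG3 using sub by (intro lie.span_minimal) auto
  have "l \<in> P" if "l \<in> L"
    using that
  proof (induction rule: graded_induct)
    case zero
    show ?case by (rule P0)
  next
    case (add x y)
    then show ?case by (intro P_add)
  next
    case (homogeneous q \<mu> x)
    then show ?case
      using G_eq_0 P0 hom part0 G_subset_root_part[OF homogeneous(2)] by (cases "q \<in> S") blast+
  qed
  then show "l \<in> L \<Longrightarrow> \<exists>c. (l, 0, 0, c) \<in> core" by (auto simp: P_def)
qed

definition core_centre :: "('k, 'l, 'g) reflection_ambient set" where
  "core_centre = lie_centre dx.brE core"

lemma core_centre_eq: "core_centre = {x \<in> core. fst x = 0}"
proof (intro set_eqI iffI)
  fix z assume z: "z \<in> core_centre"
  obtain l n d c where z_eq: "z = (l, n, d, c)" by (cases z)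
  have core: "(l, n, d, c) \<in> core" using z by (simp add: core_centre_def lie_centre_def z_eq)
  then have l: "l \<in> L" and nd: "n = 0" "d = 0" using core_in_E core_shape by auto
  have "br l x = 0" if xL: "x \<in> L" for x
  proof -
    obtain c' where x: "(x, 0, 0, c') \<in> core" using core_projection xL by blast
    then have "dx.brE z (x, 0, 0, c') = 0"
      using z unfolding core_centre_def lie_centre_def by blast
    then show ?thesis using xL l by (simp add: z_eq nd zero_prod_def)
  qed
  then have "l = 0" using centreless l by blast
  then show "z \<in> {x \<in> core. fst x = 0}" using core by (simp add: z_eq)
next
  fix z assume z: "z \<in> {x \<in> core. fst x = 0}"
  obtain l n d c where z_eq: "z = (l, n, d, c)" by (cases z)
  have nd: "n = 0" "d = 0" "l = 0" using z core_shape by (auto simp: z_eq)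
  have "dx.brE z x = 0" if "x \<in> core" for x
  proof -
    obtain l' n' d' c' where x: "x = (l', n', d', c')" by (cases x)
    then have "l' \<in> L" "d' = 0" using that core_shape core_in_E by auto
    then show ?thesis
      by (auto simp: z_eq nd x zero_prod_def dx.cocycle_def fun_eq_iff degree_derivation_zero)
  qed
  then show "z \<in> core_centre" using z by (simp add: core_centre_def lie_centre_def)
qed

text \<open>
  The fibres of the projection of the core to \<open>L\<close> are the cosets of its centre, so this map is the
  isomorphism from \<open>L\<close> to the centreless core.
\<close>

definition core_fibre :: "'l \<Rightarrow> ('k, 'l, 'g) reflection_ambient set" where
  "core_fibre l = {x \<in> core. fst x = l}"

lemma coset_eq_fibre:
  assumes "x \<in> core"
  shows "x +o core_centre = core_fibre (fst x)"
proof (intro set_eqI iffI)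
  fix y assume "y \<in> x +o core_centre"
  then obtain z where "y = x + z" "z \<in> core" "fst z = 0"
    by (auto simp: elt_set_plus_def core_centre_eq)
  then show "y \<in> core_fibre (fst x)"
    using assms dx.ambient.subspace_add[OF subspace_core] by (simp add: core_fibre_def)
next
  fix y assume y: "y \<in> core_fibre (fst x)"
  then have "y - x \<in> core_centre"
    using assms dx.ambient.subspace_diff[OF subspace_core]
    by (simp add: core_fibre_def core_centre_eq)
  moreover have "y = x + (y - x)" by simp
  ultimately show "y \<in> x +o core_centre" unfolding elt_set_plus_def by blast
qed

lemma core_fst:
  assumes "x \<in> core" "y \<in> core"
  shows "fst x \<in> L" "fst (x + y) = fst x + fst y" "fst (dx.scaleE a x) = scaleL a (fst x)"
    "fst (dx.brE x y) = br (fst x) (fst y)"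
proof -
  obtain l n d c where x: "x = (l, n, d, c)" by (cases x)
  obtain l' n' d' c' where y: "y = (l', n', d', c')" by (cases y)
  have "l \<in> L" "l' \<in> L" "d = 0" "d' = 0" using assms core_in_E core_shape unfolding x y by auto
  then show "fst x \<in> L" "fst (x + y) = fst x + fst y" "fst (dx.scaleE a x) = scaleL a (fst x)"
    "fst (dx.brE x y) = br (fst x) (fst y)" by (simp_all add: x y)
qed

lemma fibre_nonempty: "l \<in> L \<Longrightarrow> \<exists>x\<in>core. fst x = l"
  using core_projection by force

lemma core_quotient_isomorphic:
  "lie_isomorphic L (+) scaleL br (quotient_carrier core core_centre) (+)
     (quotient_scale dx.scaleE core_centre) (quotient_bracket dx.brE core_centre)"
  unfolding lie_isomorphic_def
proof (intro exI[of _ core_fibre] conjI ballI allI)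
  have "inj_on core_fibre L"
  proof (rule inj_onI)
    fix l l' assume "l \<in> L" "core_fibre l = core_fibre l'"
    then show "l = l'" using fibre_nonempty by (auto simp: core_fibre_def)
  qed
  moreover have "core_fibre ` L = quotient_carrier core core_centre"
  proof -
    have "fst ` core = L" using fibre_nonempty core_fst(1) by force
    then have "core_fibre ` L = (\<lambda>x. core_fibre (fst x)) ` core" by (metis image_image)
    also have "\<dots> = (\<lambda>x. x +o core_centre) ` core"
      by (intro image_cong) (simp_all add: coset_eq_fibre)
    finally show ?thesis by (simp add: quotient_carrier_def)
  qed
  ultimately show "bij_betw core_fibre L (quotient_carrier core core_centre)"
    by (simp add: bij_betw_def)
next
  fix l l' assume "l \<in> L" "l' \<in> L"
  then obtain x x' where x: "x \<in> core" "fst x = l" and x': "x' \<in> core" "fst x' = l'"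
    using fibre_nonempty by blast
  show "core_fibre (l + l') = core_fibre l + core_fibre l'"
  proof (intro set_eqI iffI)
    fix y assume y: "y \<in> core_fibre (l + l')"
    then have "y - x \<in> core" "fst (y - x) = l'"
      using x dx.ambient.subspace_diff[OF subspace_core] by (auto simp: core_fibre_def)
    then have "x + (y - x) \<in> core_fibre l + core_fibre l'"
      using x by (intro set_plus_intro) (auto simp: core_fibre_def)
    then show "y \<in> core_fibre l + core_fibre l'" by simp
  next
    fix y assume "y \<in> core_fibre l + core_fibre l'"
    then show "y \<in> core_fibre (l + l')"
      using dx.ambient.subspace_add[OF subspace_core]
      by (auto elim!: set_plus_elim simp: core_fibre_def)
  qed
  have "dx.brE y y' +o core_centre = core_fibre (br l l')"
    if "y \<in> core_fibre l" "y' \<in> core_fibre l'" for y y'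
    using that coset_eq_fibre[OF core_br, of y y'] core_fst(4)[of y y'] by (simp add: core_fibre_def)
  moreover have "x \<in> core_fibre l" "x' \<in> core_fibre l'" using x x' by (simp_all add: core_fibre_def)
  ultimately show "core_fibre (br l l') =
      quotient_bracket dx.brE core_centre (core_fibre l) (core_fibre l')"
    unfolding quotient_bracket_def by blast
next
  fix a l assume "l \<in> L"
  then obtain x where x: "x \<in> core" "fst x = l" using fibre_nonempty by blast
  have "dx.scaleE a y +o core_centre = core_fibre (scaleL a l)" if "y \<in> core_fibre l" for y
    using that coset_eq_fibre[OF dx.ambient.subspace_scale[OF subspace_core], of y a]
      core_fst(3)[of y y a] by (simp add: core_fibre_def)
  moreover have "x \<in> core_fibre l" using x by (simp add: core_fibre_def)
  ultimately show "core_fibre (scaleL a l) = quotient_scale dx.scaleE core_centre a (core_fibre l)"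
    unfolding quotient_scale_def by blast
qed

end

theorem mainTheorem6:
  fixes scaleL :: "'k::field_char_0 \<Rightarrow> 'l::ab_group_add \<Rightarrow> 'l"
    and L :: "'l set" and brL :: "'l \<Rightarrow> 'l \<Rightarrow> 'l"
    and scaleY :: "'k \<Rightarrow> 'y::ab_group_add \<Rightarrow> 'y"
    and S :: "'y set" and coroot :: "'y \<Rightarrow> 'y \<Rightarrow> 'k"
    and G :: "'y \<Rightarrow> 'g::ab_group_add \<Rightarrow> 'l set"
  assumes "locally_finite_root_system scaleY S coroot"
    and "torsion_free_group TYPE('g)"
    and "invariant_predivision_root_graded_lie_algebra scaleL L brL scaleY S coroot G"
  shows "\<exists>(scaleE :: 'k \<Rightarrow> ('k, 'l, 'g) reflection_ambient \<Rightarrow> ('k, 'l, 'g) reflection_ambient) E brE T \<phi>.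
    invariant_affine_reflection_algebra scaleE E brE T \<phi> \<and>
    (let E\<^sub>c = toral_pair.core scaleE E brE T \<phi>; Z = lie_centre brE E\<^sub>c in
      lie_isomorphic L (+) scaleL brL
        (quotient_carrier E\<^sub>c Z) (+) (quotient_scale scaleE Z) (quotient_bracket brE Z))"
proof -
  interpret invariant_predivision_root_graded_lie_algebra scaleL L brL scaleY S coroot G
    by (rule assms(3))
  obtain \<phi> e f where "lie.invariant_form \<phi>" "nondegenerate_on L \<phi>"
    "\<forall>\<mu> \<nu>. \<mu> + \<nu> \<noteq> 0 \<longrightarrow> (\<forall>x\<in>Lambda_part \<mu>. \<forall>y\<in>Lambda_part \<nu>. \<phi> x y = 0)"
    "\<forall>\<alpha>\<in>root.S_ind - {0}. invertible_with_inverse \<alpha> 0 (e \<alpha>) (f \<alpha>)"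
    "nondegenerate_on (lie.span {brL (e \<alpha>) (f \<alpha>) |\<alpha>. \<alpha> \<in> root.S_ind - {0}}) \<phi>"
    using invariant by blast
  then interpret reflection_construction scaleL L brL scaleY S coroot G \<phi> e f
    by unfold_locales auto
  show ?thesis
    using iara.invariant_affine_reflection_algebra_axioms core_quotient_isomorphic
    unfolding core_centre_def core_def Let_def by blast
qed

end
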